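(* Let $a,b$ be non-negative integers and let $p$ be a prime with $p>a+b+3$. If $a+b$ is odd, then $$S_{p-1}(\{1\}^a,2,\{1\}^b)\equiv \frac{(-1)^b}{a+b+2}\binom{a+b+2}{a+1}B_{p-a-b-2}\pmod{p},$$ $$H_{p-1}(\{1\}^a,2,\{1\}^b)\equiv \frac{(-1)^b}{a+b+2}\binom{a+b+2}{a+1}B_{p-a-b-2}\pmod{p}.$$ If $a+b$ is even, then $$S_{p-1}(\{1\}^a,2,\{1\}^b)\equiv \frac{p\,B_{p-a-b-3}}{2(a+b+3)}\left(1+(-1)^a\binom{a+b+3}{a+2}\right)\pmod{p^2},$$ $$H_{p-1}(\{1\}^a,2,\{1\}^b)\equiv \frac{p\,B_{p-a-b-3}}{2(a+b+3)}\left(1+(-1)^a\binom{a+b+3}{b+2}\right)\pmod{p^2}.$$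
   Context: For a sequence $(s_1,\dots,s_r)$ of positive integers and an integer $n\ge 0$: $H_n(s_1,\dots,s_r)=\sum_{1\le k_1<\cdots<k_r\le n}\frac{1}{k_1^{s_1}\cdots k_r^{s_r}}$ and $S_n(s_1,\dots,s_r)=\sum_{1\le k_1\le\cdots\le k_r\le n}\frac{1}{k_1^{s_1}\cdots k_r^{s_r}}$, with $H_n=0$ if $n<r$. $\{1\}^a$ denotes $1$ repeated $a$ times. $B_k$ are the Bernoulli numbers defined by $\frac{x}{e^x-1}=\sum_{k\ge0}B_k\frac{x^k}{k!}$. For rational numbers $x,y$, $x\equiv y\pmod{p^k}$ means that $x-y$ has $p$-adic valuation at least $k$. *)

theory Defs
  imports
    "HOL-Computational_Algebra.Primes"
    "HOL-Computational_Algebra.Formal_Power_Series"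
begin

text \<open>A multi-index is the list of its exponents, and a tuple $(k_1,\dots,k_r)$ of summation
  indices is a list of the same length. For \<open>r > 0\<close>, \<open>mhs n s = 0\<close> whenever
  \<open>n < r\<close>, since then no strictly increasing tuple exists.\<close>

definition mhs :: "nat \<Rightarrow> nat list \<Rightarrow> rat" where
  "mhs n s =
    (\<Sum>k | length k = length s \<and> set k \<subseteq> {1..n} \<and> sorted_wrt (<) k.
       1 / (\<Prod>i<length s. of_nat (k ! i) ^ (s ! i)))"

definition mhs_star :: "nat \<Rightarrow> nat list \<Rightarrow> rat" where
  "mhs_star n s =
    (\<Sum>k | length k = length s \<and> set k \<subseteq> {1..n} \<and> sorted_wrt (\<le>) k.
       1 / (\<Prod>i<length s. of_nat (k ! i) ^ (s ! i)))"

text \<open>Both index sets are finite, so neither sum collapses to \<open>0\<close> by convention.\<close>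

lemma finite_mhs_index:
  "finite {k :: nat list. length k = r \<and> set k \<subseteq> {1..n} \<and> P k}"
  by (rule finite_subset[OF _ finite_lists_length_eq[of "{1..n}" r]]) auto

text \<open>The division is that of formal power series, where the common factor \<open>x\<close> of
  \<open>x\<close> and \<open>e\<^sup>x - 1\<close> cancels.\<close>

definition bernoulli :: "nat \<Rightarrow> rat" where
  "bernoulli k = fact k * fps_nth (fps_X / (fps_exp 1 - 1)) k"

lemma bernoulli_egf:
  "Abs_fps (\<lambda>k. bernoulli k / fact k) * (fps_exp 1 - 1) = fps_X"
proof -
  let ?E = "fps_exp 1 - 1 :: rat fps"
  have nz: "?E \<noteq> 0"
    using fps_exp_neq_0 by (auto simp: fps_eq_iff intro!: exI[of _ 1])
  have "subdegree ?E = 1"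
    by (rule subdegreeI) auto
  then have "?E dvd fps_X"
    using nz by (subst fps_dvd_iff) auto
  moreover have "Abs_fps (\<lambda>k. bernoulli k / fact k) = fps_X / ?E"
    by (simp add: fps_eq_iff bernoulli_def)
  ultimately show ?thesis
    by simp
qed

text \<open>The \<open>p\<close>-adic valuation of a nonzero rational number. At \<open>0\<close>, where the
  valuation is infinite, the value of \<open>padic_val\<close> is meaningless; \<open>rat_cong\<close>
  treats this case separately.\<close>

definition padic_val :: "nat \<Rightarrow> rat \<Rightarrow> int" where
  "padic_val p x =
    int (multiplicity (int p) (fst (quotient_of x)))
    - int (multiplicity (int p) (snd (quotient_of x)))"

definition rat_cong :: "rat \<Rightarrow> rat \<Rightarrow> nat \<Rightarrow> nat \<Rightarrow> bool" where
  "rat_cong x y p k \<longleftrightarrow> x = y \<or> int k \<le> padic_val p (x - y)"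

end

theory Submission
  imports Defs "HOL-Number_Theory.Residues"
begin

text \<open>
  Put \<open>n = p - 1\<close>, \<open>s = a + 1\<close>, \<open>t = b + 1\<close>, and write \<open>H m s\<close> for the sum of \<open>1 / j ^ s\<close> over
  \<open>1 \<le> j \<le> m\<close>. The sum over tuples of length \<open>a + b + 1\<close> collapses to a sum over pairs by duality: the
  transform \<open>T f n = (\<Sum>m=1..n. (-1) ^ (m - 1) * (n choose m) * f m)\<close> exchanges the two elementary
  operations by which a star sum is built up, so that the star sum is exactly the transform of
  \<open>H m s / m ^ t\<close> (\<open>mhs_star_ones_two_ones\<close>). For \<open>n = p - 1\<close> the binomial coefficient is
  \<open>(-1) ^ m * (1 - p * H m 1)\<close> modulo \<open>p\<^sup>2\<close>, hence the star sum is \<open>- Q s t + p * W s t\<close>, where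
  \<open>Q s t\<close> is the double sum of \<open>H m s / m ^ t\<close> and \<open>W s t\<close> the sum of \<open>H m 1 * H m s / m ^ t\<close>.

  Modulo \<open>p\<close>, Fermat's theorem and Faulhaber's formula express \<open>Q s t\<close> by a single Bernoulli number
  (\<open>double_sum_bernoulli\<close>). This settles the star sum for odd \<open>a + b\<close>.

  For even \<open>a + b\<close> the reflection \<open>k \<mapsto> p - k\<close> lowers the depth. Applied to \<open>Q\<close> it gives \<open>2 * Q s t\<close>
  modulo \<open>p\<^sup>2\<close> in terms of the power sum \<open>H (p - 1) (s + t)\<close> and \<open>p\<close> times double sums of odd weight
  (\<open>double_sum_even_weight\<close>); applied to \<open>W\<close> it gives \<open>2 * W s t\<close> modulo \<open>p\<close> as a sum of two double
  sums (\<open>weighted_sum_even_weight\<close>). The power sum itself is found modulo \<open>p\<^sup>2\<close> by computing the star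
  sum over repeated ones both by Newton's identity and by the transform (\<open>harm_pow_even_cong\<close>). All
  terms are then multiples of the same Bernoulli number.

  The strict sums follow from the star sums by the antipode relation (\<open>mhs_antipode\<close>), which
  connects the star sum of a multi-index with the strict sum of the reversed one. Its mixed terms
  vanish to the required order, since sums over repeated ones are divisible by \<open>p\<close>, and by \<open>p\<^sup>2\<close> when
  their number is odd (\<open>mhs_rev_mod_p\<close>, \<open>mhs_rev_mod_p2\<close>). The reversal accounts for the exchange
  of \<open>a\<close> and \<open>b\<close> between the two kinds of sums.
\<close>

section \<open>Recurrences and the antipode relation\<close>

text \<open>The last entry of a monotone tuple bounds all the others, so summing over it first leaves a sum
  over shorter tuples. The bound \<open>f k\<close> covers both orders at once: it is \<open>k - 1\<close> for strictly
  and \<open>k\<close> for weakly increasing tuples.\<close>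

lemma sum_over_snoc:
  fixes g :: "nat list \<Rightarrow> rat"
  assumes R: "\<And>x k. 1 \<le> x \<Longrightarrow> 1 \<le> k \<Longrightarrow> R x k \<longleftrightarrow> x \<le> f k" and f: "\<And>k. f k \<le> k"
  shows "(\<Sum>x | length x = Suc r \<and> set x \<subseteq> {1..n} \<and> sorted_wrt R x. g x) =
    (\<Sum>k=1..n. \<Sum>l | length l = r \<and> set l \<subseteq> {1..f k} \<and> sorted_wrt R l. g (l @ [k]))"
proof -
  let ?I = "\<lambda>k. {l. length l = r \<and> set l \<subseteq> {1..f k} \<and> sorted_wrt R l}"
  have split: "x \<in> {x. length x = Suc r \<and> set x \<subseteq> {1..n} \<and> sorted_wrt R x} \<longleftrightarrow>
      (\<exists>l k. x = l @ [k] \<and> k \<in> {1..n} \<and> l \<in> ?I k)" for x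
  proof
    assume x: "x \<in> {x. length x = Suc r \<and> set x \<subseteq> {1..n} \<and> sorted_wrt R x}"
    then obtain l k where x_eq: "x = l @ [k]"
      by (cases x rule: rev_cases) auto
    have k: "k \<in> {1..n}" and l: "\<And>y. y \<in> set l \<Longrightarrow> y \<in> {1..n} \<and> R y k"
      using x by (auto simp: x_eq sorted_wrt_append)
    have "set l \<subseteq> {1..f k}"
      using l k R by fastforce
    then show "\<exists>l k. x = l @ [k] \<and> k \<in> {1..n} \<and> l \<in> ?I k"
      using x k x_eq by (auto simp: sorted_wrt_append)
  next
    assume "\<exists>l k. x = l @ [k] \<and> k \<in> {1..n} \<and> l \<in> ?I k"
    then obtain l k where x_eq: "x = l @ [k]" and k: "k \<in> {1..n}" and l: "l \<in> ?I k"
      by blast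
    have "y \<in> {1..n} \<and> R y k" if "y \<in> set l" for y
      using that l k f[of k] R[of y k] by (auto simp: subset_iff)
    then show "x \<in> {x. length x = Suc r \<and> set x \<subseteq> {1..n} \<and> sorted_wrt R x}"
      using l k by (auto simp: x_eq sorted_wrt_append)
  qed
  have "(\<Sum>k=1..n. \<Sum>l\<in>?I k. g (l @ [k])) = (\<Sum>(k, l)\<in>(SIGMA k:{1..n}. ?I k). g (l @ [k]))"
    by (rule sum.Sigma) (simp_all add: finite_mhs_index del: One_nat_def)
  also have "\<dots> = (\<Sum>x | length x = Suc r \<and> set x \<subseteq> {1..n} \<and> sorted_wrt R x. g x)"
    by (rule sum.reindex_bij_witness[where j = "\<lambda>(k, l). l @ [k]" and i = "\<lambda>x. (last x, butlast x)"])
       (use split in auto)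
  finally show ?thesis ..
qed

lemma prod_nth_snoc:
  assumes "length l = length s"
  shows "(\<Prod>i<length (s @ [t]). of_nat ((l @ [k]) ! i) ^ ((s @ [t]) ! i)) =
    (\<Prod>i<length s. of_nat (l ! i) ^ (s ! i)) * (of_nat k ^ t :: rat)"
  using assms by (auto simp: nth_append intro!: prod.cong)

lemma mhs_snoc: "mhs n (s @ [t]) = (\<Sum>k=1..n. mhs (k - 1) s / of_nat k ^ t)"
proof -
  have "mhs n (s @ [t]) = (\<Sum>k=1..n. \<Sum>l | length l = length s \<and> set l \<subseteq> {1..k - 1} \<and> sorted_wrt (<) l.
      1 / (\<Prod>i<length (s @ [t]). of_nat ((l @ [k]) ! i) ^ ((s @ [t]) ! i)))"
    unfolding mhs_def length_append_singleton
    by (rule sum_over_snoc) auto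
  also have "\<dots> = (\<Sum>k=1..n. mhs (k - 1) s / of_nat k ^ t)"
    unfolding mhs_def sum_divide_distrib
    by (intro sum.cong refl) (subst prod_nth_snoc, auto)
  finally show ?thesis .
qed

lemma mhs_star_snoc: "mhs_star n (s @ [t]) = (\<Sum>k=1..n. mhs_star k s / of_nat k ^ t)"
proof -
  have "mhs_star n (s @ [t]) = (\<Sum>k=1..n. \<Sum>l | length l = length s \<and> set l \<subseteq> {1..k} \<and> sorted_wrt (\<le>) l.
      1 / (\<Prod>i<length (s @ [t]). of_nat ((l @ [k]) ! i) ^ ((s @ [t]) ! i)))"
    unfolding mhs_star_def length_append_singleton
    by (rule sum_over_snoc) auto
  also have "\<dots> = (\<Sum>k=1..n. mhs_star k s / of_nat k ^ t)"
    unfolding mhs_star_def sum_divide_distrib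
    by (intro sum.cong refl) (subst prod_nth_snoc, auto)
  finally show ?thesis .
qed

lemma mhs_Nil [simp]: "mhs n [] = 1" and mhs_star_Nil [simp]: "mhs_star n [] = 1"
proof -
  have "{k. length k = length ([] :: nat list) \<and> set k \<subseteq> {1..n} \<and> sorted_wrt R k} = {[]}" for R
    by auto
  then show "mhs n [] = 1" "mhs_star n [] = 1"
    by (simp_all add: mhs_def mhs_star_def)
qed

lemma mhs_0: "s \<noteq> [] \<Longrightarrow> mhs 0 s = 0"
  by (cases s rule: rev_cases) (auto simp: mhs_snoc)

lemma mhs_star_0: "s \<noteq> [] \<Longrightarrow> mhs_star 0 s = 0"
  by (cases s rule: rev_cases) (auto simp: mhs_star_snoc)

lemma mhs_Suc_snoc: "mhs (Suc n) (s @ [t]) = mhs n (s @ [t]) + mhs n s / of_nat (Suc n) ^ t"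
  by (simp add: mhs_snoc)

lemma mhs_star_Suc_snoc:
  "mhs_star (Suc n) (s @ [t]) = mhs_star n (s @ [t]) + mhs_star (Suc n) s / of_nat (Suc n) ^ t"
  by (simp add: mhs_star_snoc)

text \<open>The convolution formula for the antipode of quasi-symmetric functions, evaluated at
  \<open>1, 1/2, \<dots>, 1/n\<close>. It is the multi-index form of the relation
  \<open>\<Sum>i. (-1) ^ i * h i * e (r - i) = 0\<close> between complete and elementary symmetric functions,
  and it is what turns the star sums into the strict ones.\<close>

lemma mhs_antipode:
  assumes "s \<noteq> []"
  shows "(\<Sum>i\<le>length s. (-1) ^ i * mhs_star n (take i s) * mhs n (rev (drop i s))) = 0"
proof -
  define r where "r = length s"
  define A where "A n i = (-1) ^ i * mhs_star n (take i s)" for n i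
  define C where "C n i = mhs n (rev (drop i s))" for n i
  define q where "q n i = 1 / (of_nat (Suc n) ^ (s ! i) :: rat)" for n i
  have A_step: "A (Suc n) (Suc i) = A n (Suc i) - q n i * A (Suc n) i" if "i < r" for n i
    using that by (simp add: A_def q_def r_def take_Suc_conv_app_nth mhs_star_Suc_snoc algebra_simps)
  have C_step: "C (Suc n) i = C n i + q n i * C n (Suc i)" if "i < r" for n i
    using that by (simp add: C_def q_def r_def mhs_Suc_snoc flip: Cons_nth_drop_Suc)
  have A0: "A n 0 = 1" and Cr: "C n r = 1" for n
    by (simp_all add: A_def C_def r_def)
  \<comment> \<open>Moving the bound from \<open>n\<close> to \<open>Suc n\<close> in one factor at a time produces correction terms that
    cancel between neighbouring values of \<open>i\<close>.\<close>
  have step: "(\<Sum>i\<le>r. A (Suc n) i * C (Suc n) i) = (\<Sum>i\<le>r. A n i * C n i)" for n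
  proof -
    have "(\<Sum>i\<le>r. A (Suc n) i * C (Suc n) i) = (\<Sum>i<r. A (Suc n) i * C (Suc n) i) + A (Suc n) r"
      by (simp add: lessThan_Suc_atMost[symmetric] Cr)
    also have "(\<Sum>i<r. A (Suc n) i * C (Suc n) i) =
        (\<Sum>i<r. A (Suc n) i * C n i) + (\<Sum>i<r. q n i * A (Suc n) i * C n (Suc i))"
      by (simp add: C_step sum.distrib[symmetric] algebra_simps)
    also have "(\<Sum>i<r. A (Suc n) i * C n i) + (\<Sum>i<r. q n i * A (Suc n) i * C n (Suc i)) + A (Suc n) r =
        (\<Sum>i\<le>r. A (Suc n) i * C n i) + (\<Sum>i<r. q n i * A (Suc n) i * C n (Suc i))"
      by (simp add: lessThan_Suc_atMost[symmetric] Cr)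
    also have "(\<Sum>i\<le>r. A (Suc n) i * C n i) = C n 0 + (\<Sum>i<r. A (Suc n) (Suc i) * C n (Suc i))"
      by (simp add: sum.atMost_shift A0)
    also have "C n 0 + (\<Sum>i<r. A (Suc n) (Suc i) * C n (Suc i)) + (\<Sum>i<r. q n i * A (Suc n) i * C n (Suc i))
        = C n 0 + (\<Sum>i<r. A n (Suc i) * C n (Suc i))"
      by (simp add: A_step sum.distrib[symmetric] algebra_simps)
    also have "\<dots> = (\<Sum>i\<le>r. A n i * C n i)"
      by (simp add: sum.atMost_shift A0)
    finally show ?thesis .
  qed
  have "(\<Sum>i\<le>r. A n i * C n i) = (\<Sum>i\<le>r. A 0 i * C 0 i)"
    by (induction n) (simp_all add: step)
  also have "\<dots> = 0"
  proof (rule sum.neutral, safe)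
    fix i assume "i \<le> r"
    show "A 0 i * C 0 i = 0"
    proof (cases "i = 0")
      case True
      then show ?thesis using assms by (simp add: C_def mhs_0)
    next
      case False
      then show ?thesis using assms \<open>i \<le> r\<close> by (simp add: A_def mhs_star_0)
    qed
  qed
  finally show ?thesis by (simp add: A_def C_def r_def)
qed

section \<open>Newton's identity for complete sums\<close>

text \<open>This is the depth-one sum, equally \<open>mhs n [s]\<close> and \<open>mhs_star n [s]\<close>.\<close>

definition harm_pow :: "nat \<Rightarrow> nat \<Rightarrow> rat" where
  "harm_pow s n = (\<Sum>j=1..n. 1 / of_nat j ^ s)"

lemma harm_pow_0 [simp]: "harm_pow s 0 = 0"
  by (simp add: harm_pow_def)

lemma harm_pow_Suc: "harm_pow s (Suc n) = harm_pow s n + 1 / of_nat (Suc n) ^ s"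
  by (simp add: harm_pow_def)

lemma replicate_Suc_snoc: "replicate (Suc w) x = replicate w x @ [x]"
  by (simp flip: replicate_append_same)

text \<open>Newton's identity for the complete symmetric functions of \<open>1, 1/2, \<dots>, 1/n\<close>: if \<open>F\<close> is their
  generating function, then \<open>F\<close> is the product of the series \<open>1 / (1 - X / j)\<close>, and \<open>X * F' / F\<close>
  generates the power sums.\<close>

lemma newton_identity:
  "of_nat w * mhs_star n (replicate w 1) =
    (\<Sum>i=1..w. harm_pow i n * mhs_star n (replicate (w - i) 1))"
proof -
  define F where "F n = Abs_fps (\<lambda>w. mhs_star n (replicate w 1))" for n
  define P where "P n = Abs_fps (\<lambda>i. if i = 0 then 0 else harm_pow i n)" for n
  define L where "L n = (1 - fps_const (1 / of_nat (Suc n)) * fps_X :: rat fps)" for n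
  have F_step: "L n * F (Suc n) = F n" for n
  proof (rule fps_ext)
    fix w
    show "fps_nth (L n * F (Suc n)) w = fps_nth (F n) w"
      by (cases w) (simp_all add: L_def F_def algebra_simps replicate_Suc_snoc mhs_star_Suc_snoc
          del: replicate_Suc)
  qed
  have P_step: "L n * (P (Suc n) - P n) = fps_const (1 / of_nat (Suc n)) * fps_X" for n
  proof (rule fps_ext)
    fix w
    show "fps_nth (L n * (P (Suc n) - P n)) w = fps_nth (fps_const (1 / of_nat (Suc n)) * fps_X) w"
      by (cases w) (auto simp: L_def P_def algebra_simps harm_pow_Suc add_divide_distrib)
  qed
  have L_nz: "L n \<noteq> 0" for n
  proof
    assume "L n = 0"
    then have "fps_nth (L n) 0 = 0" by simp
    then show False by (simp add: L_def)
  qed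
  have L_deriv: "fps_X * fps_deriv (L n) = - (fps_const (1 / of_nat (Suc n)) * fps_X)" for n
    by (simp add: L_def mult.commute flip: fps_const_neg)
  have "fps_X * fps_deriv (F n) = F n * P n" for n
  proof (induction n)
    case 0
    have "F 0 = 1"
      by (rule fps_ext) (auto simp: F_def mhs_star_0)
    moreover have "P 0 = 0"
      by (rule fps_ext) (auto simp: P_def)
    ultimately show ?case by simp
  next
    case (Suc n)
    have "L n * (F (Suc n) * P n) = fps_X * fps_deriv (L n * F (Suc n))"
      using Suc F_step[of n] by (simp flip: mult.assoc)
    also have "\<dots> = L n * (fps_X * fps_deriv (F (Suc n))) + (fps_X * fps_deriv (L n)) * F (Suc n)"
      by (simp add: algebra_simps)
    also have "(fps_X * fps_deriv (L n)) * F (Suc n) = - (L n * (P (Suc n) - P n)) * F (Suc n)"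
      by (simp only: L_deriv P_step)
    finally have "L n * (F (Suc n) * P (Suc n)) = L n * (fps_X * fps_deriv (F (Suc n)))"
      by (simp add: algebra_simps)
    then show ?case by (simp only: mult_left_cancel[OF L_nz])
  qed
  then have "fps_nth (fps_X * fps_deriv (F n)) w = fps_nth (P n * F n) w"
    by (simp add: mult.commute)
  moreover have "fps_nth (fps_X * fps_deriv (F n)) w = of_nat w * mhs_star n (replicate w 1)"
    by (cases w) (simp_all add: F_def)
  ultimately have "of_nat w * mhs_star n (replicate w 1) =
      (\<Sum>i=0..w. fps_nth (P n) i * mhs_star n (replicate (w - i) 1))"
    by (simp add: fps_mult_nth F_def)
  also have "\<dots> = (\<Sum>i=1..w. harm_pow i n * mhs_star n (replicate (w - i) 1))"
    by (rule sum.mono_neutral_cong_right) (auto simp: P_def)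
  finally show ?thesis .
qed

section \<open>The alternating binomial transform\<close>

definition binom_transform :: "(nat \<Rightarrow> rat) \<Rightarrow> nat \<Rightarrow> rat" where
  "binom_transform f n = (\<Sum>m=1..n. (-1) ^ (m - 1) * of_nat (n choose m) * f m)"

text \<open>Up to sign this is the \<open>n\<close>-th forward difference of \<open>g\<close> at \<open>1\<close>. It is the increment of the
  transform of \<open>g\<close> from \<open>n\<close> to \<open>Suc n\<close>, and also the transform of the partial sums of \<open>g\<close> at \<open>Suc n\<close>.
  Computing it for \<open>g m = f m / m\<close> turns these two facts into the two rules for the transform.\<close>

definition binom_diff :: "(nat \<Rightarrow> rat) \<Rightarrow> nat \<Rightarrow> rat" where
  "binom_diff g n = (\<Sum>m\<le>n. (-1) ^ m * of_nat (n choose m) * g (Suc m))"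

lemma binom_transform_Suc_shift:
  "binom_transform f (Suc n) = (\<Sum>m\<le>n. (-1) ^ m * of_nat (Suc n choose Suc m) * f (Suc m))"
  unfolding binom_transform_def
  by (rule sum.reindex_bij_witness[where i = Suc and j = "\<lambda>m. m - 1"]) auto

lemma binom_transform_shift:
  "binom_transform f n = (\<Sum>m\<le>n. (-1) ^ m * of_nat (n choose Suc m) * f (Suc m))"
proof -
  have "(\<Sum>m\<le>n. (-1) ^ m * of_nat (n choose Suc m) * f (Suc m)) = (\<Sum>m<n. (-1) ^ m * of_nat (n choose Suc m) * f (Suc m))"
    by (rule sum.mono_neutral_right) auto
  also have "\<dots> = binom_transform f n"
    unfolding binom_transform_def
    by (rule sum.reindex_bij_witness[where j = Suc and i = "\<lambda>m. m - 1"]) auto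
  finally show ?thesis ..
qed

lemma binom_transform_Suc: "binom_transform g (Suc n) = binom_transform g n + binom_diff g n"
  unfolding binom_transform_Suc_shift binom_transform_shift[of g n] binom_diff_def
  by (simp add: algebra_simps sum.distrib)

lemma binom_diff_div: "binom_diff (\<lambda>m. f m / of_nat m) n = binom_transform f (Suc n) / of_nat (Suc n)"
proof -
  have "of_nat (n choose m) / of_nat (Suc m) = (of_nat (Suc n choose Suc m) / of_nat (Suc n) :: rat)" for m
  proof -
    have "of_nat (Suc n * (n choose m)) = (of_nat ((Suc n choose Suc m) * Suc m) :: rat)"
      using Suc_times_binomial_eq by metis
    then show ?thesis by (simp only: of_nat_mult frac_eq_eq of_nat_eq_0_iff nat.distinct simp_thms) (simp add: mult.commute)
  qed
  then have "(-1) ^ m * of_nat (n choose m) * (f (Suc m) / of_nat (Suc m)) =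
      (-1) ^ m * of_nat (Suc n choose Suc m) * f (Suc m) / (of_nat (Suc n) :: rat)" for m
    by (metis (no_types, lifting) times_divide_eq_left times_divide_eq_right mult.commute mult.assoc)
  then show ?thesis
    unfolding binom_diff_def binom_transform_Suc_shift sum_divide_distrib by simp
qed

lemma binom_transform_sum:
  "binom_transform (\<lambda>m. \<Sum>j=1..m. g j) (Suc n) = binom_diff g n"
proof -
  define G where "G m = (\<Sum>j=1..m. g j)" for m
  have "binom_transform G (Suc n) =
      (\<Sum>m\<le>n. (-1) ^ m * of_nat (n choose m) * G (Suc m)) + (\<Sum>m\<le>n. (-1) ^ m * of_nat (n choose Suc m) * G (Suc m))"
    unfolding binom_transform_Suc_shift by (simp add: algebra_simps sum.distrib)
  also have "(\<Sum>m\<le>n. (-1) ^ m * of_nat (n choose Suc m) * G (Suc m)) =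
      (\<Sum>m\<le>Suc n. (-1) ^ (m + 1) * of_nat (n choose m) * G m)"
    by (simp add: sum.atMost_Suc_shift G_def del: sum.atMost_Suc)
  also have "\<dots> = (\<Sum>m\<le>n. (-1) ^ (m + 1) * of_nat (n choose m) * G m)"
    by simp
  finally show ?thesis
    by (simp add: G_def binom_diff_def sum.distrib[symmetric] algebra_simps)
qed

text \<open>Appending an exponent \<open>1\<close> to a star sum corresponds to dividing \<open>f m\<close> by \<open>m\<close>.\<close>

lemma sum_binom_transform_div:
  "(\<Sum>k=1..n. binom_transform f k / of_nat k) = binom_transform (\<lambda>m. f m / of_nat m) n"
proof (induction n)
  case 0
  then show ?case by (simp add: binom_transform_def)
next
  case (Suc n)
  then show ?case by (simp add: binom_transform_Suc[of "\<lambda>m. f m / of_nat m"] binom_diff_div)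
qed

text \<open>The rule dual to the preceding one. Dividing a star sum by its bound raises the exponent that is
  appended next, and corresponds to taking partial sums of \<open>f j / j\<close>.\<close>

lemma binom_transform_div:
  assumes "n \<ge> 1"
  shows "binom_transform f n / of_nat n = binom_transform (\<lambda>m. \<Sum>j=1..m. f j / of_nat j) n"
  using assms by (cases n) (simp_all add: binom_transform_sum binom_diff_div del: One_nat_def of_nat_Suc)

lemma binom_transform_one:
  assumes "n \<ge> 1"
  shows "binom_transform (\<lambda>_. 1) n = 1"
proof -
  have "binom_transform (\<lambda>_. 1) (Suc m) = 1" for m
  proof (induction m)
    case (Suc m)
    then show ?case
      using choose_alternating_sum[of "Suc m", where 'a = rat]
      by (simp add: binom_transform_Suc[of _ "Suc m"] binom_diff_def del: sum.atMost_Suc binomial_Suc_Suc)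
  qed (simp add: binom_transform_def)
  then show ?thesis using assms by (cases n) auto
qed

lemma mhs_star_append_ones:
  assumes "\<And>k. k \<ge> 1 \<Longrightarrow> mhs_star k s = binom_transform f k" and "n \<ge> 1"
  shows "mhs_star n (s @ replicate b 1) = binom_transform (\<lambda>m. f m / of_nat m ^ b) n"
  using \<open>n \<ge> 1\<close>
proof (induction b arbitrary: n)
  case 0
  then show ?case using assms by simp
next
  case (Suc b)
  have "mhs_star n (s @ replicate (Suc b) 1) = mhs_star n ((s @ replicate b 1) @ [1])"
    by (simp only: replicate_Suc_snoc append_assoc)
  also have "\<dots> = (\<Sum>k=1..n. binom_transform (\<lambda>m. f m / of_nat m ^ b) k / of_nat k)"
    unfolding mhs_star_snoc by (intro sum.cong refl) (simp add: Suc.IH del: One_nat_def)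
  also have "\<dots> = binom_transform (\<lambda>m. f m / of_nat m ^ Suc b) n"
    by (simp add: sum_binom_transform_div mult.commute del: One_nat_def)
  finally show ?case .
qed

lemma mhs_star_ones:
  assumes "n \<ge> 1"
  shows "mhs_star n (replicate a 1) = binom_transform (\<lambda>m. 1 / of_nat m ^ a) n"
  using mhs_star_append_ones[of "[]" "\<lambda>_. 1" n a] assms by (simp add: binom_transform_one)

text \<open>Hoffman's duality for the composition \<open>(1, \<dots>, 1, 2, 1, \<dots>, 1)\<close>, whose conjugate is
  \<open>(a + 1, b + 1)\<close>: building up the multi-index from left to right divides \<open>a\<close> times by \<open>m\<close>, takes
  partial sums once, and then divides \<open>b\<close> more times. A star sum of arbitrary depth becomes a sum
  over pairs.\<close>

lemma mhs_star_ones_two_ones: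
  assumes "n \<ge> 1"
  shows "mhs_star n (replicate a 1 @ [2] @ replicate b 1) =
    binom_transform (\<lambda>m. harm_pow (a + 1) m / of_nat m ^ (b + 1)) n"
proof -
  have "mhs_star k (replicate a 1 @ [2]) = binom_transform (\<lambda>m. harm_pow (a + 1) m / of_nat m) k" for k
  proof -
    have "mhs_star k (replicate a 1 @ [2]) =
        (\<Sum>i=1..k. binom_transform (\<lambda>m. 1 / of_nat m ^ a) i / of_nat i / of_nat i)"
      unfolding mhs_star_snoc by (intro sum.cong refl) (simp add: mhs_star_ones power2_eq_square del: One_nat_def)
    also have "\<dots> = (\<Sum>i=1..k. binom_transform (harm_pow (a + 1)) i / of_nat i)"
      by (intro sum.cong refl) (simp add: binom_transform_div harm_pow_def[abs_def] mult.commute)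
    finally show ?thesis by (simp only: sum_binom_transform_div)
  qed
  from mhs_star_append_ones[OF this assms] show ?thesis
    by (simp add: mult.commute)
qed

section \<open>Faulhaber's formula\<close>

text \<open>Compare coefficients in \<open>X * (\<Sum>j<n. exp (j X)) = (X / (exp X - 1)) * (exp (n X) - 1)\<close>. The case
  \<open>n = 1\<close> is the recursion that defines the Bernoulli numbers.\<close>

lemma bernoulli_faulhaber:
  "(\<Sum>j<n. of_nat j ^ m) / fact m =
    (\<Sum>i\<le>m. bernoulli i / fact i * (of_nat n ^ (m + 1 - i) / fact (m + 1 - i)))"
proof -
  define E where "E = (fps_exp 1 - 1 :: rat fps)"
  define Bf where "Bf = Abs_fps (\<lambda>k. bernoulli k / fact k)"
  define S where "S = (\<Sum>j<n. fps_exp (of_nat j) :: rat fps)"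
  have E_nz: "E \<noteq> 0"
    unfolding E_def by (auto simp: fps_eq_iff intro!: exI[of _ 1])
  have "E * S = fps_exp (of_nat n) - 1"
    unfolding S_def
  proof (induction n)
    case (Suc n)
    have "fps_exp (of_nat (Suc n)) = (fps_exp 1 * fps_exp (of_nat n) :: rat fps)"
      by (simp flip: fps_exp_add_mult)
    then show ?case using Suc by (simp add: E_def algebra_simps)
  qed simp
  then have "E * (fps_X * S) = fps_X * (fps_exp (of_nat n) - 1)"
    by (simp only: mult.left_commute[of E fps_X S])
  also have "fps_X * (fps_exp (of_nat n) - 1) = (Bf * E) * (fps_exp (of_nat n) - 1)"
    unfolding E_def Bf_def bernoulli_egf ..
  finally have "E * (fps_X * S) = E * (Bf * (fps_exp (of_nat n) - 1))"
    by (simp only: mult_ac)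
  then have eq: "fps_X * S = Bf * (fps_exp (of_nat n) - 1)"
    using E_nz by simp
  have S_nth: "fps_nth S m = (\<Sum>j<n. of_nat j ^ m) / fact m"
    by (simp add: S_def fps_sum_nth sum_divide_distrib)
  have "fps_nth S m = fps_nth (fps_X * S) (m + 1)"
    by simp
  also have "\<dots> = (\<Sum>i=0..m+1. bernoulli i / fact i * fps_nth (fps_exp (of_nat n) - 1) (m + 1 - i))"
    by (simp only: eq fps_mult_nth) (simp add: Bf_def)
  also have "\<dots> = (\<Sum>i\<le>m. bernoulli i / fact i * (of_nat n ^ (m + 1 - i) / fact (m + 1 - i)))"
    by (rule sum.mono_neutral_cong_right) auto
  finally show ?thesis by (simp only: S_nth)
qed

section \<open>Rational numbers modulo powers of a prime\<close>

locale rat_mod_prime =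
  fixes p :: nat
  assumes prime: "prime p"
begin

text \<open>The ideal \<open>p ^ k\<close> of the localization of the integers at \<open>p\<close>; for \<open>k = 0\<close> it is the ring of
  \<open>p\<close>-integral rationals.\<close>

definition pideal :: "nat \<Rightarrow> rat set" where
  "pideal k = {x. \<exists>u v :: int. \<not> int p dvd v \<and> x = of_int (int p ^ k * u) / of_int v}"

definition congp :: "nat \<Rightarrow> rat \<Rightarrow> rat \<Rightarrow> bool" where
  "congp k x y \<longleftrightarrow> x - y \<in> pideal k"

lemma prime_int: "prime (int p)"
  using prime by simp

lemma pidealI: "\<not> int p dvd v \<Longrightarrow> x = of_int (int p ^ k * u) / of_int v \<Longrightarrow> x \<in> pideal k"
  unfolding pideal_def by blast

lemma pidealE:
  assumes "x \<in> pideal k"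
  obtains u v where "\<not> int p dvd v" "v \<noteq> 0" "x = of_int (int p ^ k * u) / of_int v"
  using assms unfolding pideal_def by auto

lemma pideal_of_int: "of_int u \<in> pideal 0"
  using prime_int by (intro pidealI[of 1 _ _ u]) (auto dest: not_prime_unit)

lemma pideal_0 [simp]: "0 \<in> pideal k"
  using prime_int by (intro pidealI[of 1 _ _ 0]) (auto dest: not_prime_unit)

lemma pideal_of_nat [simp]: "of_nat n \<in> pideal 0"
  using pideal_of_int[of "int n"] by simp

lemma pideal_1 [simp]: "1 \<in> pideal 0"
  using pideal_of_nat[of 1] by simp

lemma pideal_numeral [simp]: "numeral n \<in> pideal 0"
  using pideal_of_nat[of "numeral n"] by simp

lemma pideal_p: "of_nat p \<in> pideal 1"
  using prime_int by (intro pidealI[of 1 _ _ 1]) (auto dest: not_prime_unit)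

lemma pideal_add: "x \<in> pideal k \<Longrightarrow> y \<in> pideal k \<Longrightarrow> x + y \<in> pideal k"
proof (elim pidealE)
  fix u v u' v' :: int
  assume *: "\<not> int p dvd v" "v \<noteq> 0" "x = of_int (int p ^ k * u) / of_int v"
    "\<not> int p dvd v'" "v' \<noteq> 0" "y = of_int (int p ^ k * u') / of_int v'"
  then show "x + y \<in> pideal k"
    using prime_int
    by (intro pidealI[of "v * v'" _ _ "u * v' + u' * v"]) (auto simp: prime_dvd_mult_iff field_simps)
qed

lemma pideal_mult: "x \<in> pideal k \<Longrightarrow> y \<in> pideal l \<Longrightarrow> x * y \<in> pideal (k + l)"
proof (elim pidealE)
  fix u v u' v' :: int
  assume *: "\<not> int p dvd v" "v \<noteq> 0" "x = of_int (int p ^ k * u) / of_int v"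
    "\<not> int p dvd v'" "v' \<noteq> 0" "y = of_int (int p ^ l * u') / of_int v'"
  then show "x * y \<in> pideal (k + l)"
    using prime_int
    by (intro pidealI[of "v * v'" _ _ "u * u'"]) (simp_all add: prime_dvd_mult_iff power_add mult_ac)
qed

lemma pideal_mult_left: "x \<in> pideal 0 \<Longrightarrow> y \<in> pideal k \<Longrightarrow> x * y \<in> pideal k"
  using pideal_mult[of x 0 y k] by simp

lemma pideal_mult_right: "x \<in> pideal k \<Longrightarrow> y \<in> pideal 0 \<Longrightarrow> x * y \<in> pideal k"
  using pideal_mult[of x k y 0] by simp

lemma pideal_mult_11: "x \<in> pideal 1 \<Longrightarrow> y \<in> pideal 1 \<Longrightarrow> x * y \<in> pideal 2"
  using pideal_mult[of x 1 y 1] by (simp add: numeral_2_eq_2)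

lemma pideal_uminus: "x \<in> pideal k \<Longrightarrow> - x \<in> pideal k"
  using pideal_mult_left[OF pideal_of_int[of "-1"]] by simp

lemma pideal_diff: "x \<in> pideal k \<Longrightarrow> y \<in> pideal k \<Longrightarrow> x - y \<in> pideal k"
  using pideal_add[OF _ pideal_uminus, of x k y] by simp

lemma pideal_antimono: "x \<in> pideal k \<Longrightarrow> l \<le> k \<Longrightarrow> x \<in> pideal l"
proof (elim pidealE)
  fix u v :: int
  assume *: "l \<le> k" "\<not> int p dvd v" "x = of_int (int p ^ k * u) / of_int v"
  have "int p ^ k = int p ^ l * int p ^ (k - l)"
    using \<open>l \<le> k\<close> by (simp flip: power_add)
  then show ?thesis
    using * by (intro pidealI[of v _ _ "int p ^ (k - l) * u"]) auto
qed

lemma pideal_power: "x \<in> pideal 0 \<Longrightarrow> x ^ n \<in> pideal 0"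
  by (induction n) (auto intro: pideal_mult_left)

lemma pideal_sum: "(\<And>i. i \<in> I \<Longrightarrow> f i \<in> pideal k) \<Longrightarrow> (\<Sum>i\<in>I. f i) \<in> pideal k"
  by (induction I rule: infinite_finite_induct) (auto intro: pideal_add)

lemma pideal_inverse: "\<not> p dvd m \<Longrightarrow> 1 / of_nat m \<in> pideal 0"
  by (intro pidealI[of "int m" _ _ 1]) auto

lemma not_dvd_less: "0 < m \<Longrightarrow> m < p \<Longrightarrow> \<not> p dvd m"
  by (auto dest: dvd_imp_le)

lemma pideal_inverse_less: "0 < m \<Longrightarrow> m < p \<Longrightarrow> 1 / of_nat m \<in> pideal 0"
  by (intro pideal_inverse not_dvd_less)

lemma pideal_inverse_power: "0 < m \<Longrightarrow> m < p \<Longrightarrow> 1 / of_nat m ^ s \<in> pideal 0"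
  using pideal_power[OF pideal_inverse_less, of m s] by (simp add: power_divide)

lemma pideal_cancel:
  assumes "of_nat m * x \<in> pideal k" "0 < m" "m < p"
  shows "x \<in> pideal k"
  using pideal_mult_left[OF pideal_inverse_less[of m] assms(1)] assms by simp

lemma pideal_fact: "m < p \<Longrightarrow> 1 / fact m \<in> pideal 0"
proof -
  assume "m < p"
  then have "\<not> p dvd fact m"
    using prime by (simp add: prime_dvd_fact_iff)
  then show ?thesis
    using pideal_inverse[of "fact m"] by simp
qed

lemma rat_congI:
  assumes "congp k x y" shows "rat_cong x y p k"
proof (cases "x = y")
  case False
  define z where "z = x - y"
  have z: "z \<noteq> 0" "z \<in> pideal k"
    using assms False by (auto simp: z_def congp_def)
  obtain n d where nd: "quotient_of z = (n, d)" by fastforce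
  have "d > 0" "coprime n d" and z_eq: "z = of_int n / of_int d"
    using nd quotient_of_denom_pos quotient_of_coprime quotient_of_div by blast+
  have "n \<noteq> 0" using z z_eq by auto
  obtain u v where uv: "\<not> int p dvd v" "v \<noteq> 0" "z = of_int (int p ^ k * u) / of_int v"
    using z(2) by (rule pidealE)
  have "of_int (n * v) = (of_int (int p ^ k * u * d) :: rat)"
    using z_eq uv \<open>d > 0\<close> by (simp add: field_simps)
  then have eq: "n * v = int p ^ k * u * d"
    by (simp only: of_int_eq_iff)
  \<comment> \<open>A factor \<open>p\<close> of the reduced denominator would divide \<open>n * v\<close>, hence also the numerator.\<close>
  have "\<not> int p dvd d"
  proof
    assume "int p dvd d"
    then have "int p dvd n * v" using eq by simp
    then have "int p dvd n" using uv prime_int by (simp add: prime_dvd_mult_iff)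
    then show False
      using \<open>int p dvd d\<close> \<open>coprime n d\<close> prime_int by (meson coprime_common_divisor not_prime_unit)
  qed
  then have "multiplicity (int p) d = 0"
    by (rule not_dvd_imp_multiplicity_0)
  moreover have "int p ^ k dvd n"
  proof -
    have "coprime (int p ^ k) v"
      using uv prime_int by (simp add: prime_imp_coprime)
    moreover have "int p ^ k dvd n * v" using eq by simp
    ultimately show ?thesis by (simp add: coprime_dvd_mult_left_iff)
  qed
  then have "k \<le> multiplicity (int p) n"
    using \<open>n \<noteq> 0\<close> prime_int by (intro multiplicity_geI) (auto dest: not_prime_unit)
  ultimately show ?thesis
    using nd by (simp add: rat_cong_def padic_val_def z_def)
qed (simp add: rat_cong_def)

lemma congp_refl [simp]: "congp k x x"
  by (simp add: congp_def)

lemma congp_sym: "congp k x y \<Longrightarrow> congp k y x"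
  unfolding congp_def using pideal_uminus[of "x - y"] by simp

lemma congp_trans [trans]: "congp k x y \<Longrightarrow> congp k y z \<Longrightarrow> congp k x z"
  unfolding congp_def using pideal_add[of "x - y" k "y - z"] by simp

lemma congp_add: "congp k x y \<Longrightarrow> congp k x' y' \<Longrightarrow> congp k (x + x') (y + y')"
  unfolding congp_def using pideal_add[of "x - y" k "x' - y'"] by (simp add: algebra_simps)

lemma congp_uminus: "congp k x y \<Longrightarrow> congp k (- x) (- y)"
  unfolding congp_def using pideal_uminus[of "x - y" k] by simp

lemma congp_diff: "congp k x y \<Longrightarrow> congp k x' y' \<Longrightarrow> congp k (x - x') (y - y')"
  using congp_add[OF _ congp_uminus, of k x y x' y'] by simp

lemma congp_sum: "(\<And>i. i \<in> I \<Longrightarrow> congp k (f i) (g i)) \<Longrightarrow> congp k (\<Sum>i\<in>I. f i) (\<Sum>i\<in>I. g i)"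
  unfolding congp_def using pideal_sum[of I "\<lambda>i. f i - g i" k] by (simp add: sum_subtractf)

lemma congp_mult_left: "congp k x y \<Longrightarrow> c \<in> pideal 0 \<Longrightarrow> congp k (c * x) (c * y)"
  unfolding congp_def using pideal_mult_left[of c "x - y" k] by (simp add: algebra_simps)

lemma congp_mult_right: "congp k x y \<Longrightarrow> c \<in> pideal 0 \<Longrightarrow> congp k (x * c) (y * c)"
  unfolding congp_def using pideal_mult_right[of "x - y" k c] by (simp add: algebra_simps)

lemma congp_mult_p: "congp 1 x y \<Longrightarrow> congp 2 (of_nat p * x) (of_nat p * y)"
  unfolding congp_def using pideal_mult_11[OF pideal_p, of "x - y"] by (simp add: algebra_simps)

lemma congp_antimono: "congp k x y \<Longrightarrow> l \<le> k \<Longrightarrow> congp l x y"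
  unfolding congp_def by (rule pideal_antimono)

lemma congp_cancel: "congp k (of_nat m * x) (of_nat m * y) \<Longrightarrow> 0 < m \<Longrightarrow> m < p \<Longrightarrow> congp k x y"
  unfolding congp_def using pideal_cancel[of m "x - y" k] by (simp add: algebra_simps)

lemma congp_0_iff: "congp k x 0 \<longleftrightarrow> x \<in> pideal k"
  by (simp add: congp_def)

lemma congp_pideal: "congp k x y \<Longrightarrow> y \<in> pideal k \<Longrightarrow> x \<in> pideal k"
  unfolding congp_def using pideal_add[of "x - y" k y] by simp

lemma congp_power:
  assumes "congp k x y" "x \<in> pideal 0" "y \<in> pideal 0"
  shows "congp k (x ^ n) (y ^ n)"
proof (induction n)
  case (Suc n)
  have "congp k (x * x ^ n) (x * y ^ n)"
    using Suc assms by (intro congp_mult_left)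
  also have "congp k (x * y ^ n) (y * y ^ n)"
    using assms by (intro congp_mult_right pideal_power)
  finally show ?case by simp
qed simp

lemma congp_of_nat:
  assumes "[m = n] (mod p)" shows "congp 1 (of_nat m) (of_nat n)"
proof -
  have "int p dvd int m - int n"
    using assms by (metis cong_iff_dvd_diff cong_int_iff)
  then obtain u where "int m - int n = int p * u" by (elim dvdE)
  then have "of_int (int m - int n) = (of_int (int p * u) :: rat)"
    by (simp only:)
  then have "of_nat m - of_nat n = (of_nat p * of_int u :: rat)"
    by simp
  then show ?thesis
    unfolding congp_def by (simp add: pideal_mult_right pideal_p pideal_of_int del: One_nat_def)
qed

section \<open>Power sums modulo a prime\<close>

text \<open>The recursion expresses \<open>bernoulli m\<close> through earlier values with the single new denominator
  \<open>m + 1\<close>, which is prime to \<open>p\<close> as long as \<open>m + 1 < p\<close>.\<close>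

lemma bernoulli_pideal:
  assumes "m + 1 < p" shows "bernoulli m \<in> pideal 0"
  using assms
proof (induction m rule: less_induct)
  case (less m)
  define f where "f i = bernoulli i / fact i * (1 / fact (m + 1 - i))" for i
  have "(\<Sum>i\<le>m. f i) = 0 ^ m / fact m"
    using bernoulli_faulhaber[of m 1] by (simp add: f_def)
  also have "(\<Sum>i\<le>m. f i) = (\<Sum>i<m. f i) + f m"
    by (simp flip: lessThan_Suc_atMost)
  also have "f m = bernoulli m / fact m"
    by (simp add: f_def)
  finally have "bernoulli m = 0 ^ m - fact m * (\<Sum>i<m. f i)"
    by (simp add: field_simps)
  also have "\<dots> \<in> pideal 0"
  proof (intro pideal_diff pideal_mult_left pideal_sum)
    show "0 ^ m \<in> pideal 0" by (cases m) auto
    show "fact m \<in> pideal 0"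
      using pideal_of_nat[of "fact m"] by simp
    fix i assume "i \<in> {..<m}"
    then have i: "i < m" by simp
    have "bernoulli i * (1 / fact i) * (1 / fact (m + 1 - i)) \<in> pideal 0"
      using less i by (intro pideal_mult_left pideal_fact) auto
    then show "f i \<in> pideal 0" by (simp add: f_def)
  qed
  finally show ?case .
qed

lemma fermat: "0 < k \<Longrightarrow> k < p \<Longrightarrow> congp 1 (of_nat k ^ (p - 1)) 1"
  using congp_of_nat[OF fermat_theorem[OF prime not_dvd_less, of k]] by simp

lemma power_cong_mod:
  assumes "0 < k" "k < p"
  shows "congp 1 (of_nat k ^ e) (of_nat k ^ (e mod (p - 1)))"
proof -
  have "congp 1 ((of_nat k ^ (p - 1)) ^ (e div (p - 1)) * of_nat k ^ (e mod (p - 1)))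
      (1 ^ (e div (p - 1)) * of_nat k ^ (e mod (p - 1)))"
    using assms by (intro congp_mult_right congp_power fermat pideal_power) auto
  also have "(of_nat k ^ (p - 1)) ^ (e div (p - 1)) * of_nat k ^ (e mod (p - 1)) = (of_nat k ^ e :: rat)"
    by (simp flip: power_mult power_add)
  finally show ?thesis by simp
qed

text \<open>Every term of Faulhaber's formula contains a positive power of \<open>p\<close>, and for exponents below
  \<open>p - 1\<close> its other factors are \<open>p\<close>-integral.\<close>

lemma sum_power_less:
  assumes "0 < e" "e < p - 1"
  shows "(\<Sum>k=1..p-1. of_nat k ^ e) \<in> pideal 1"
proof -
  have "(\<Sum>k=1..p-1. of_nat k ^ e) = (\<Sum>k<p. of_nat k ^ e :: rat)"
    using assms by (intro sum.mono_neutral_left) auto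
  also have "\<dots> = fact e * (\<Sum>i\<le>e. bernoulli i / fact i * (of_nat p ^ (e + 1 - i) / fact (e + 1 - i)))"
    by (simp only: bernoulli_faulhaber[symmetric]) simp
  also have "\<dots> \<in> pideal 1"
  proof (rule pideal_mult_left[OF _ pideal_sum])
    show "fact e \<in> pideal 0"
      using pideal_of_nat[of "fact e"] by simp
    fix i assume "i \<in> {..e}"
    then have i: "i \<le> e" by simp
    have "(bernoulli i * (1 / fact i) * of_nat p ^ (e - i) * (1 / fact (e + 1 - i))) * of_nat p \<in> pideal 1"
      using assms i
      by (intro pideal_mult_left[OF _ pideal_p] pideal_mult_left pideal_fact bernoulli_pideal pideal_power) auto
    moreover have "of_nat p ^ (e + 1 - i) = (of_nat p ^ (e - i) * of_nat p :: rat)"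
      using i by (simp add: Suc_diff_le)
    ultimately show "bernoulli i / fact i * (of_nat p ^ (e + 1 - i) / fact (e + 1 - i)) \<in> pideal 1"
      by (simp add: mult_ac)
  qed
  finally show ?thesis .
qed

lemma sum_power:
  "congp 1 (\<Sum>k=1..p-1. of_nat k ^ e) (if (p - 1) dvd e then -1 else 0)"
proof -
  have "congp 1 (\<Sum>k=1..p-1. of_nat k ^ e) (\<Sum>k=1..p-1. of_nat k ^ (e mod (p - 1)))"
    by (intro congp_sum power_cong_mod) auto
  also have "congp 1 (\<Sum>k=1..p-1. of_nat k ^ (e mod (p - 1))) (if (p - 1) dvd e then -1 else 0)"
  proof (cases "(p - 1) dvd e")
    case True
    have "of_nat (p - 1) - (-1) = (of_nat p :: rat)"
      using prime_gt_0_nat[OF prime] by (simp add: of_nat_diff)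
    then have "congp 1 (of_nat (p - 1)) (-1)"
      unfolding congp_def using pideal_p by (simp only:)
    then show ?thesis using True by simp
  next
    case False
    have "e mod (p - 1) < p - 1"
      using prime_gt_1_nat[OF prime] by simp
    moreover have "0 < e mod (p - 1)" using False by (simp add: mod_greater_zero_iff_not_dvd)
    ultimately show ?thesis
      using False by (simp only: if_False congp_0_iff) (rule sum_power_less)
  qed
  finally show ?thesis .
qed

lemma inverse_power_cong:
  assumes "0 < k" "k < p" "s \<le> p - 1"
  shows "congp 1 (1 / of_nat k ^ s) (of_nat k ^ (p - 1 - s))"
proof -
  have "congp 1 (1 / of_nat k ^ s * of_nat k ^ (p - 1)) (1 / of_nat k ^ s * 1)"
    using assms by (intro congp_mult_left fermat pideal_inverse_power)
  moreover have "of_nat k ^ (p - 1) = (of_nat k ^ s * of_nat k ^ (p - 1 - s) :: rat)"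
    using assms by (simp flip: power_add)
  ultimately show ?thesis
    using assms by (simp add: congp_sym)
qed

lemma harm_pow_pideal: "n < p \<Longrightarrow> harm_pow s n \<in> pideal 0"
  unfolding harm_pow_def by (intro pideal_sum pideal_inverse_power) auto

lemma harm_pow_pideal_1:
  assumes "0 < s" "s < p - 1"
  shows "harm_pow s (p - 1) \<in> pideal 1"
proof -
  have "congp 1 (harm_pow s (p - 1)) (\<Sum>k=1..p-1. of_nat k ^ (p - 1 - s))"
    unfolding harm_pow_def using assms by (intro congp_sum inverse_power_cong) auto
  moreover have "(\<Sum>k=1..p-1. of_nat k ^ (p - 1 - s)) \<in> pideal 1"
    using assms by (intro sum_power_less) auto
  ultimately show ?thesis by (rule congp_pideal)
qed

section \<open>The binomial transform modulo the square of a prime\<close>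

text \<open>The left side is the product of the factors \<open>1 - p / j\<close> with \<open>1 \<le> j \<le> m\<close>; only its terms of
  degree at most one in \<open>p\<close> survive.\<close>

lemma binomial_cong:
  assumes "m < p"
  shows "congp 2 ((-1) ^ m * of_nat ((p - 1) choose m)) (1 - of_nat p * harm_pow 1 m)"
  using assms
proof (induction m)
  case (Suc m)
  define c where "c m = ((-1) ^ m * of_nat ((p - 1) choose m) :: rat)" for m
  define x where "x = (of_nat p / of_nat (Suc m) :: rat)"
  have inv: "1 / of_nat (Suc m) \<in> pideal 0"
    using Suc.prems by (intro pideal_inverse_less) auto
  have x_int: "x \<in> pideal 0"
    unfolding x_def using pideal_mult_left[OF pideal_of_nat[of p] inv] by simp
  have "Suc m * ((p - 1) choose Suc m) = (p - 1 - m) * ((p - 1) choose m)"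
    using binomial_absorb_comp[of "p - 1" m] binomial_absorption[of m "p - 1"] by simp
  then have "of_nat (Suc m) * of_nat ((p - 1) choose Suc m) =
      (of_nat (p - 1 - m) * of_nat ((p - 1) choose m) :: rat)"
    by (simp only: flip: of_nat_mult)
  moreover have "of_nat (p - 1 - m) = (of_nat p - of_nat (Suc m) :: rat)"
    using Suc.prems by (simp add: of_nat_diff)
  ultimately have "of_nat ((p - 1) choose Suc m) =
      (of_nat p - of_nat (Suc m)) * of_nat ((p - 1) choose m) / (of_nat (Suc m) :: rat)"
    by (simp add: field_simps del: of_nat_Suc)
  also have "\<dots> = of_nat ((p - 1) choose m) * (x - 1)"
    by (simp add: x_def field_simps del: of_nat_Suc)
  finally have choose_eq: "of_nat ((p - 1) choose Suc m) = of_nat ((p - 1) choose m) * (x - 1)" .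
  have "c (Suc m) = c m * (1 - x)"
    unfolding c_def choose_eq by (simp add: algebra_simps)
  also have "congp 2 (c m * (1 - x)) ((1 - of_nat p * harm_pow 1 m) * (1 - x))"
    unfolding c_def using Suc x_int by (intro congp_mult_right pideal_diff) auto
  also have "congp 2 ((1 - of_nat p * harm_pow 1 m) * (1 - x)) (1 - of_nat p * harm_pow 1 (Suc m))"
  proof -
    have "(1 - of_nat p * harm_pow 1 m) * (1 - x) - (1 - of_nat p * harm_pow 1 (Suc m)) =
        (of_nat p * of_nat p) * (harm_pow 1 m * (1 / of_nat (Suc m)))"
      by (simp add: x_def harm_pow_Suc algebra_simps del: of_nat_Suc)
    also have "\<dots> \<in> pideal 2"
      using Suc.prems inv
      by (intro pideal_mult_right pideal_mult_11 pideal_p pideal_mult_left harm_pow_pideal) auto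
    finally show ?thesis by (simp add: congp_def)
  qed
  finally show ?case by (simp add: c_def)
qed simp

lemma binom_transform_cong:
  assumes "\<And>m. 1 \<le> m \<Longrightarrow> m < p \<Longrightarrow> f m \<in> pideal 0"
  shows "congp 2 (binom_transform f (p - 1))
    (- (\<Sum>m=1..p-1. f m) + of_nat p * (\<Sum>m=1..p-1. harm_pow 1 m * f m))"
proof -
  have "congp 2 (\<Sum>m=1..p-1. (-1) ^ m * of_nat ((p - 1) choose m) * f m)
      (\<Sum>m=1..p-1. (1 - of_nat p * harm_pow 1 m) * f m)"
    using assms by (intro congp_sum congp_mult_right binomial_cong) auto
  then have "congp 2 (- (\<Sum>m=1..p-1. (-1) ^ m * of_nat ((p - 1) choose m) * f m))
      (- (\<Sum>m=1..p-1. (1 - of_nat p * harm_pow 1 m) * f m))"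
    by (rule congp_uminus)
  moreover have "- (\<Sum>m=1..p-1. (-1) ^ m * of_nat ((p - 1) choose m) * f m) = binom_transform f (p - 1)"
    unfolding binom_transform_def sum_negf[symmetric]
  proof (intro sum.cong refl)
    fix m assume "m \<in> {1..p-1}"
    then show "- ((-1) ^ m * of_nat ((p - 1) choose m) * f m) =
        (-1) ^ (m - 1) * of_nat ((p - 1) choose m) * f m"
      by (cases m) auto
  qed
  ultimately show ?thesis
    by (simp add: algebra_simps sum_subtractf sum_distrib_left del: One_nat_def)
qed

section \<open>Double sums\<close>

text \<open>This is the depth-two star sum \<open>mhs_star (p - 1) [s, t]\<close>.\<close>

definition double_sum :: "nat \<Rightarrow> nat \<Rightarrow> rat" where
  "double_sum s t = (\<Sum>k=1..p-1. harm_pow s k / of_nat k ^ t)"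

lemma divide_power_pideal:
  "x \<in> pideal 0 \<Longrightarrow> 0 < k \<Longrightarrow> k < p \<Longrightarrow> x / of_nat k ^ t \<in> pideal 0"
  using pideal_mult_left[OF _ pideal_inverse_power, of x k t] by simp

lemma double_sum_pideal: "double_sum s t \<in> pideal 0"
  unfolding double_sum_def
  by (intro pideal_sum divide_power_pideal harm_pow_pideal) auto

text \<open>Modulo \<open>p\<close>, the \<open>u\<close> factors just below \<open>p - s\<close> are the negatives of the factors just above \<open>s\<close>.\<close>

lemma fact_quotient_cong:
  assumes "s + u < p"
  shows "congp 1 (fact (p - 1 - s) / fact (p - 1 - s - u)) ((-1) ^ u * (fact (s + u) / fact s))"
  using assms
proof (induction u)
  case (Suc u)
  define q where "q = p - 1 - s - Suc u"
  have q: "p - 1 - s - u = Suc q"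
    using Suc.prems by (simp add: q_def)
  have p_eq: "of_nat p = (of_nat (Suc q) + of_nat (s + Suc u) :: rat)"
    using Suc.prems by (simp add: q_def flip: of_nat_add)
  have "congp 1 (of_nat (Suc q)) (- of_nat (s + Suc u))"
    unfolding congp_def using pideal_p by (simp only: p_eq diff_minus_eq_add)
  moreover have "fact (s + u) / fact s \<in> pideal 0"
  proof -
    have "fact s dvd (fact (s + u) :: nat)"
      by (simp add: fact_dvd)
    then obtain r where "(fact (s + u) :: nat) = fact s * r" by (elim dvdE)
    then have "of_nat (fact (s + u)) = (of_nat (fact s * r) :: rat)" by (simp only:)
    then have "fact (s + u) / fact s = (of_nat r :: rat)" by simp
    then show ?thesis by simp
  qed
  ultimately have step: "congp 1 ((-1) ^ u * (fact (s + u) / fact s) * of_nat (Suc q))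
      ((-1) ^ u * (fact (s + u) / fact s) * - of_nat (s + Suc u))"
    by (intro congp_mult_left pideal_mult_left pideal_power) (auto intro: pideal_uminus)
  have "fact (p - 1 - s) / fact q = fact (p - 1 - s) / fact (p - 1 - s - u) * (of_nat (Suc q) :: rat)"
    unfolding q fact_Suc by (simp del: of_nat_Suc)
  also have "congp 1 \<dots> ((-1) ^ u * (fact (s + u) / fact s) * of_nat (Suc q))"
    using Suc by (intro congp_mult_right pideal_of_nat) auto
  also note step
  also have "(-1) ^ u * (fact (s + u) / fact s) * - of_nat (s + Suc u) =
      ((-1) ^ Suc u * (fact (s + Suc u) / fact s) :: rat)"
    by (simp add: field_simps)
  finally show ?case by (simp only: q_def)
qed simp

text \<open>Replace inverse powers by powers using Fermat's theorem, and expand the inner sum by Faulhaber's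
  formula. What remains is a combination of power sums over \<open>1, \<dots>, p - 1\<close>, which vanish modulo
  \<open>p\<close> unless \<open>p - 1\<close> divides the exponent; in the given range this leaves exactly one term.\<close>

lemma double_sum_bernoulli:
  assumes "0 < s" "0 < t" "s + t + 1 < p"
  shows "congp 1 (double_sum s t)
    ((-1) ^ t / of_nat (s + t) * of_nat ((s + t) choose s) * bernoulli (p - s - t))"
proof -
  define e where "e = p - 1 - s"
  define c where "c i = fact e * (bernoulli i * (1 / fact i) * (1 / fact (e + 1 - i)))" for i
  have c_int: "c i \<in> pideal 0" if "i \<le> e" for i
    unfolding c_def using that assms pideal_of_nat[of "fact e"]
    by (intro pideal_mult_left bernoulli_pideal pideal_fact) (auto simp: e_def)
  have harm: "congp 1 (harm_pow s (k - 1)) (\<Sum>i\<le>e. c i * of_nat k ^ (e + 1 - i))"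
    if k: "k \<in> {1..p-1}" for k
  proof -
    have "congp 1 (harm_pow s (k - 1)) (\<Sum>j=1..k-1. of_nat j ^ e)"
      unfolding harm_pow_def e_def using k assms
      by (intro congp_sum inverse_power_cong) auto
    also have "(\<Sum>j=1..k-1. of_nat j ^ e) = (\<Sum>j<k. of_nat j ^ e :: rat)"
      using assms k by (intro sum.mono_neutral_left) (auto simp: e_def)
    also have "\<dots> = fact e * ((\<Sum>j<k. of_nat j ^ e) / fact e)"
      by simp
    also have "\<dots> = (\<Sum>i\<le>e. c i * of_nat k ^ (e + 1 - i))"
      unfolding bernoulli_faulhaber sum_distrib_left by (simp add: c_def mult_ac)
    finally show ?thesis .
  qed
  have term_cong: "congp 1 (harm_pow s (k - 1) / of_nat k ^ t)
      (\<Sum>i\<le>e. c i * of_nat k ^ (e + 1 - i + (p - 1 - t)))" if k: "k \<in> {1..p-1}" for k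
  proof -
    have k': "0 < k" "k < p" using k by auto
    have "congp 1 (harm_pow s (k - 1) * (1 / of_nat k ^ t)) (harm_pow s (k - 1) * of_nat k ^ (p - 1 - t))"
      using k' assms by (intro congp_mult_left inverse_power_cong harm_pow_pideal) auto
    also have "congp 1 (harm_pow s (k - 1) * of_nat k ^ (p - 1 - t))
        ((\<Sum>i\<le>e. c i * of_nat k ^ (e + 1 - i)) * of_nat k ^ (p - 1 - t))"
      using harm[OF k] by (intro congp_mult_right pideal_power) auto
    finally show ?thesis
      by (simp only: sum_distrib_right power_add mult.assoc times_divide_eq_right mult_1_right)
  qed
  \<comment> \<open>The diagonal is split off because Faulhaber's formula sums over \<open>j < k\<close>; it is a power sum
    and vanishes modulo \<open>p\<close>.\<close>
  have split: "double_sum s t = (\<Sum>k=1..p-1. harm_pow s (k - 1) / of_nat k ^ t) + harm_pow (s + t) (p - 1)"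
  proof -
    have "harm_pow s k / of_nat k ^ t = harm_pow s (k - 1) / of_nat k ^ t + 1 / of_nat k ^ (s + t)"
      if "k \<in> {1..p-1}" for k
      using that by (cases k) (auto simp: harm_pow_Suc add_divide_distrib power_add)
    then show ?thesis
      unfolding double_sum_def harm_pow_def[of "s + t"] sum.distrib[symmetric]
      by (intro sum.cong refl)
  qed
  \<comment> \<open>The exponent lies strictly between \<open>0\<close> and \<open>2 * (p - 1)\<close>.\<close>
  have only: "(p - 1) dvd (e + 1 - i + (p - 1 - t)) \<longleftrightarrow> i = p - s - t" if "i \<le> e" for i
  proof
    define M where "M = e + 1 - i + (p - 1 - t)"
    assume "(p - 1) dvd (e + 1 - i + (p - 1 - t))"
    then obtain r where r: "M = (p - 1) * r"
      unfolding M_def by (elim dvdE)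
    have M: "0 < M" "M < (p - 1) * 2"
      using that assms by (auto simp: M_def e_def)
    have "r = 1"
    proof -
      have "r \<noteq> 0" using r M by (intro notI) simp
      moreover have "r < 2" using r M by (metis mult_less_cancel1)
      ultimately show ?thesis by simp
    qed
    then have "M = p - 1" using r by simp
    then show "i = p - s - t"
      using that assms by (auto simp: M_def e_def)
  next
    assume "i = p - s - t"
    then have "e + 1 - i + (p - 1 - t) = p - 1"
      using that assms by (auto simp: e_def)
    then show "(p - 1) dvd (e + 1 - i + (p - 1 - t))" by simp
  qed
  have "congp 1 (double_sum s t) ((\<Sum>k=1..p-1. \<Sum>i\<le>e. c i * of_nat k ^ (e + 1 - i + (p - 1 - t))) + 0)"
    unfolding split
  proof (rule congp_add)
    show "congp 1 (harm_pow (s + t) (p - 1)) 0"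
      using assms by (simp only: congp_0_iff, intro harm_pow_pideal_1) auto
  qed (intro congp_sum term_cong)
  also have "(\<Sum>k=1..p-1. \<Sum>i\<le>e. c i * of_nat k ^ (e + 1 - i + (p - 1 - t))) + 0 =
      (\<Sum>i\<le>e. c i * (\<Sum>k=1..p-1. of_nat k ^ (e + 1 - i + (p - 1 - t))))"
    by (subst sum.swap) (simp add: sum_distrib_left)
  also have "congp 1 \<dots> (\<Sum>i\<le>e. c i * (if (p - 1) dvd (e + 1 - i + (p - 1 - t)) then -1 else 0))"
    by (intro congp_sum congp_mult_left sum_power c_int) auto
  also have "\<dots> = (\<Sum>i\<le>e. if i = p - s - t then - c i else 0)"
    using only by (intro sum.cong) auto
  also have "\<dots> = - c (p - s - t)"
    using assms by (simp add: e_def)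
  also have "\<dots> = - (bernoulli (p - s - t) * (1 / fact t)) * (fact (p - 1 - s) / fact (p - 1 - s - (t - 1)))"
  proof -
    have "p - 1 - s - (t - 1) = p - s - t" "e + 1 - (p - s - t) = t"
      using assms by (auto simp: e_def)
    then show ?thesis by (simp add: c_def e_def mult_ac)
  qed
  also have "congp 1 \<dots> (- (bernoulli (p - s - t) * (1 / fact t)) * ((-1) ^ (t - 1) * (fact (s + (t - 1)) / fact s)))"
    using assms
    by (intro congp_mult_left fact_quotient_cong pideal_uminus pideal_mult_left bernoulli_pideal pideal_fact) auto
  also have "\<dots> = (-1) ^ t / of_nat (s + t) * of_nat ((s + t) choose s) * bernoulli (p - s - t)"
  proof -
    have "of_nat ((s + t) choose s) = (fact (s + t) / (fact s * fact t) :: rat)"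
      by (simp add: binomial_fact)
    moreover obtain u where "t = Suc u" using assms by (cases t) auto
    ultimately show ?thesis by (simp add: field_simps del: of_nat_Suc of_nat_add)
  qed
  finally show ?thesis .
qed

text \<open>Expand \<open>1 / (p - k) = - (1 / k) / (1 - p / k)\<close> to first order in \<open>p\<close>.\<close>

lemma inverse_reflect:
  assumes "0 < k" "k < p"
  shows "congp 2 (1 / of_nat (p - k) ^ s) ((-1) ^ s / of_nat k ^ s * (1 + of_nat p * of_nat s / of_nat k))"
proof (induction s)
  case (Suc s)
  define x where "x = (1 / of_nat k :: rat)"
  define y where "y = (1 / of_nat (p - k) :: rat)"
  have x: "x \<in> pideal 0" and y: "y \<in> pideal 0"
    unfolding x_def y_def using assms by (intro pideal_inverse_less; simp)+
  have p_int: "of_nat p * c \<in> pideal 0" if "c \<in> pideal 0" for c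
    using that by (intro pideal_mult_left) auto
  have one: "congp 2 y (- x * (1 + of_nat p * x))"
  proof -
    have "y - (- x * (1 + of_nat p * x)) = of_nat p * of_nat p * (x * x * y)"
      using assms by (simp add: x_def y_def of_nat_diff field_simps)
    also have "\<dots> \<in> pideal 2"
      using x y by (intro pideal_mult_right[OF pideal_mult_11] pideal_p pideal_mult_left)
    finally show ?thesis by (simp add: congp_def)
  qed
  have "1 / of_nat (p - k) ^ Suc s = y * (1 / of_nat (p - k) ^ s)"
    by (simp add: y_def)
  also have "congp 2 \<dots> (y * ((-1) ^ s / of_nat k ^ s * (1 + of_nat p * of_nat s / of_nat k)))"
    using Suc y by (rule congp_mult_left)
  also have "(-1) ^ s / of_nat k ^ s * (1 + of_nat p * of_nat s / of_nat k) =
      (- x) ^ s * (1 + of_nat p * (of_nat s * x))"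
    by (simp add: x_def power_minus[of "1 / of_nat k"] power_divide)
  also have "congp 2 (y * ((- x) ^ s * (1 + of_nat p * (of_nat s * x))))
      (- x * (1 + of_nat p * x) * ((- x) ^ s * (1 + of_nat p * (of_nat s * x))))"
    using x by (intro congp_mult_right[OF one] pideal_mult_left pideal_power pideal_uminus pideal_add) auto
  also have "congp 2 \<dots> ((- x) ^ Suc s * (1 + of_nat p * (of_nat (Suc s) * x)))"
  proof -
    have "- x * (1 + of_nat p * x) * ((- x) ^ s * (1 + of_nat p * (of_nat s * x))) -
        (- x) ^ Suc s * (1 + of_nat p * (of_nat (Suc s) * x)) =
        of_nat p * of_nat p * ((- x) ^ Suc s * (of_nat s * (x * x)))"
      by (simp add: algebra_simps)
    also have "\<dots> \<in> pideal 2"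
      using x by (intro pideal_mult_right[OF pideal_mult_11] pideal_p pideal_mult_left pideal_power pideal_uminus) auto
    finally show ?thesis by (simp add: congp_def)
  qed
  also have "(- x) ^ Suc s * (1 + of_nat p * (of_nat (Suc s) * x)) =
      (-1) ^ Suc s / of_nat k ^ Suc s * (1 + of_nat p * of_nat (Suc s) / of_nat k)"
    by (simp add: x_def power_minus[of "1 / of_nat k"] power_divide del: of_nat_Suc)
  finally show ?case .
qed simp

lemma inverse_reflect_1:
  assumes "0 < k" "k < p"
  shows "congp 1 (1 / of_nat (p - k) ^ s) ((-1) ^ s / of_nat k ^ s)"
proof -
  have "congp 1 (1 / of_nat (p - k) ^ s) ((-1) ^ s / of_nat k ^ s * (1 + of_nat p * of_nat s / of_nat k))"
    using inverse_reflect[OF assms] by (rule congp_antimono) simp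
  also have "congp 1 \<dots> ((-1) ^ s / of_nat k ^ s)"
  proof -
    have "(-1) ^ s / of_nat k ^ s * (1 + of_nat p * of_nat s / of_nat k) - (-1) ^ s / of_nat k ^ s =
        of_nat p * ((-1) ^ s * of_nat s * (1 / of_nat k ^ Suc s) :: rat)"
      by (simp add: algebra_simps add_divide_distrib)
    also have "\<dots> \<in> pideal 1"
      using assms
      by (intro pideal_mult_right[OF pideal_p] pideal_mult_left pideal_power pideal_inverse_power pideal_uminus) auto
    finally show ?thesis by (simp add: congp_def)
  qed
  finally show ?thesis .
qed

definition triangle :: "(nat \<times> nat) set" where
  "triangle = {(j, k). 1 \<le> j \<and> j \<le> k \<and> k \<le> p - 1}"

lemma double_sum_triangle: "double_sum s t = (\<Sum>(j, k)\<in>triangle. 1 / of_nat j ^ s * (1 / of_nat k ^ t))"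
proof -
  have "double_sum s t = (\<Sum>k=1..p-1. \<Sum>j=1..k. 1 / of_nat j ^ s * (1 / of_nat k ^ t))"
    unfolding double_sum_def harm_pow_def by (simp add: sum_divide_distrib)
  also have "\<dots> = (\<Sum>(k, j)\<in>(SIGMA k:{1..p-1}. {1..k}). 1 / of_nat j ^ s * (1 / of_nat k ^ t))"
    by (rule sum.Sigma) auto
  also have "\<dots> = (\<Sum>(j, k)\<in>triangle. 1 / of_nat j ^ s * (1 / of_nat k ^ t))"
    by (rule sum.reindex_bij_witness[where i = prod.swap and j = prod.swap]) (auto simp: triangle_def)
  finally show ?thesis .
qed

text \<open>The substitution \<open>(j, k) \<mapsto> (p - k, p - j)\<close> maps the triangle of summation onto itself and exchanges
  the two exponents.\<close>

lemma double_sum_reverse: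
  "congp 2 (double_sum s t) ((-1) ^ (s + t) *
    (double_sum t s + of_nat p * (of_nat s * double_sum t (s + 1) + of_nat t * double_sum (t + 1) s)))"
proof -
  define g where "g k s = ((-1) ^ s / of_nat k ^ s * (1 + of_nat p * of_nat s / of_nat k) :: rat)" for k s
  have bounds: "0 < j" "j < p" "0 < k" "k < p" if "(j, k) \<in> triangle" for j k
    using that prime_gt_0_nat[OF prime] by (auto simp: triangle_def)
  have g_int: "g k s \<in> pideal 0" if "0 < k" "k < p" for k s
  proof -
    have "g k s = (-1) ^ s * (1 / of_nat k ^ s) * (1 + of_nat p * (of_nat s * (1 / of_nat k)))"
      by (simp add: g_def)
    also have "\<dots> \<in> pideal 0"
      using that by (intro pideal_mult_left pideal_add pideal_power pideal_inverse_power pideal_inverse_less pideal_uminus) auto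
    finally show ?thesis .
  qed
  have "double_sum s t = (\<Sum>(j, k)\<in>triangle. 1 / of_nat (p - k) ^ s * (1 / of_nat (p - j) ^ t))"
    unfolding double_sum_triangle
    by (rule sum.reindex_bij_witness[where i = "\<lambda>(j, k). (p - k, p - j)" and j = "\<lambda>(j, k). (p - k, p - j)"])
       (auto simp: triangle_def)
  also have "congp 2 \<dots> (\<Sum>(j, k)\<in>triangle. g k s * g j t)"
  proof (intro congp_sum, clarify)
    fix j k assume jk: "(j, k) \<in> triangle"
    have "congp 2 (1 / of_nat (p - k) ^ s * (1 / of_nat (p - j) ^ t)) (g k s * (1 / of_nat (p - j) ^ t))"
      unfolding g_def using bounds[OF jk]
      by (intro congp_mult_right inverse_reflect pideal_inverse_power) auto
    also have "congp 2 (g k s * (1 / of_nat (p - j) ^ t)) (g k s * g j t)"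
      using bounds[OF jk] g_int unfolding g_def[of j]
      by (intro congp_mult_left inverse_reflect) auto
    finally show "congp 2 (1 / of_nat (p - k) ^ s * (1 / of_nat (p - j) ^ t)) (g k s * g j t)" .
  qed
  also have "congp 2 (\<Sum>(j, k)\<in>triangle. g k s * g j t)
      (\<Sum>(j, k)\<in>triangle. (-1) ^ (s + t) * (1 / of_nat j ^ t * (1 / of_nat k ^ s) +
        of_nat p * (of_nat s * (1 / of_nat j ^ t * (1 / of_nat k ^ (s + 1))) +
          of_nat t * (1 / of_nat j ^ (t + 1) * (1 / of_nat k ^ s)))))"
  proof (intro congp_sum, clarify)
    fix j k assume jk: "(j, k) \<in> triangle"
    have "g k s * g j t - (-1) ^ (s + t) * (1 / of_nat j ^ t * (1 / of_nat k ^ s) +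
        of_nat p * (of_nat s * (1 / of_nat j ^ t * (1 / of_nat k ^ (s + 1))) +
          of_nat t * (1 / of_nat j ^ (t + 1) * (1 / of_nat k ^ s)))) =
        of_nat p * of_nat p * ((-1) ^ (s + t) * of_nat s * of_nat t * (1 / of_nat k ^ (s + 1)) * (1 / of_nat j ^ (t + 1)))"
      using bounds[OF jk] by (simp add: g_def power_add field_simps)
    also have "\<dots> \<in> pideal 2"
      using bounds[OF jk]
      by (intro pideal_mult_right[OF pideal_mult_11] pideal_p pideal_mult_left pideal_inverse_power pideal_power pideal_uminus) auto
    finally show "congp 2 (g k s * g j t) ((-1) ^ (s + t) * (1 / of_nat j ^ t * (1 / of_nat k ^ s) +
        of_nat p * (of_nat s * (1 / of_nat j ^ t * (1 / of_nat k ^ (s + 1))) +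
          of_nat t * (1 / of_nat j ^ (t + 1) * (1 / of_nat k ^ s)))))"
      by (simp add: congp_def)
  qed
  also have "\<dots> = (-1) ^ (s + t) *
    (double_sum t s + of_nat p * (of_nat s * double_sum t (s + 1) + of_nat t * double_sum (t + 1) s))"
    unfolding double_sum_triangle by (simp add: case_prod_unfold sum.distrib sum_distrib_left algebra_simps)
  finally show ?thesis .
qed

lemma double_sum_shuffle:
  "double_sum s t + double_sum t s = harm_pow s (p - 1) * harm_pow t (p - 1) + harm_pow (s + t) (p - 1)"
proof -
  have "(\<Sum>k=1..n. harm_pow s k / of_nat k ^ t) + (\<Sum>k=1..n. harm_pow t k / of_nat k ^ s) =
      harm_pow s n * harm_pow t n + harm_pow (s + t) n" for n
  proof (induction n)
    case (Suc n)
    then show ?case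
      by (simp add: harm_pow_Suc power_add algebra_simps add_divide_distrib del: of_nat_Suc)
  qed simp
  then show ?thesis unfolding double_sum_def .
qed

text \<open>Reversal computes \<open>double_sum s t - double_sum t s\<close> and shuffling computes
  \<open>double_sum s t + double_sum t s\<close>; for even weight the two signs allow the sums to be added. The
  product of power sums in the shuffle relation is a product of two multiples of \<open>p\<close>.\<close>

lemma double_sum_even_weight:
  assumes "even (s + t)" "0 < s" "0 < t" "s + t < p - 1"
  shows "congp 2 (2 * double_sum s t) (harm_pow (s + t) (p - 1) +
    of_nat p * (of_nat s * double_sum t (s + 1) + of_nat t * double_sum (t + 1) s))"
proof -
  define Y where "Y = of_nat p * (of_nat s * double_sum t (s + 1) + of_nat t * double_sum (t + 1) s)"
  have "double_sum s t - (double_sum t s + Y) \<in> pideal 2"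
    using double_sum_reverse[of s t] assms by (simp add: congp_def Y_def)
  moreover have "harm_pow s (p - 1) * harm_pow t (p - 1) \<in> pideal 2"
    using assms by (intro pideal_mult_11 harm_pow_pideal_1) auto
  ultimately have "double_sum s t - (double_sum t s + Y) + harm_pow s (p - 1) * harm_pow t (p - 1) \<in> pideal 2"
    by (rule pideal_add)
  also have "double_sum s t - (double_sum t s + Y) + harm_pow s (p - 1) * harm_pow t (p - 1) =
      2 * double_sum s t - (harm_pow (s + t) (p - 1) + Y)"
    using double_sum_shuffle[of s t] by (simp add: algebra_simps)
  finally show ?thesis by (simp add: congp_def Y_def)
qed

section \<open>A reflected sum of odd weight\<close>

lemma harm_pow_reflect:
  assumes "1 \<le> m" "m < p" "0 < s" "s < p - 1"
  shows "congp 1 (harm_pow s (p - m)) (- ((-1) ^ s * harm_pow s (m - 1)))"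
proof -
  have "harm_pow s (p - 1) = harm_pow s (m - 1) + (\<Sum>j=m..p-1. 1 / of_nat j ^ s)"
    unfolding harm_pow_def using assms
    by (subst sum.union_disjoint[symmetric]) (auto intro!: sum.cong)
  also have "(\<Sum>j=m..p-1. 1 / of_nat j ^ s) = (\<Sum>i=1..p-m. 1 / of_nat (p - i) ^ s :: rat)"
    by (rule sum.reindex_bij_witness[where i = "\<lambda>j. p - j" and j = "\<lambda>j. p - j"]) (use assms in auto)
  finally have *: "harm_pow s (p - 1) - (\<Sum>i=1..p-m. 1 / of_nat (p - i) ^ s) = harm_pow s (m - 1)"
    by simp
  have "congp 1 (\<Sum>i=1..p-m. 1 / of_nat (p - i) ^ s) (\<Sum>i=1..p-m. (-1) ^ s / of_nat i ^ s)"
    using assms by (intro congp_sum inverse_reflect_1) auto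
  also have "(\<Sum>i=1..p-m. (-1) ^ s / of_nat i ^ s) = (-1) ^ s * harm_pow s (p - m)"
    by (simp add: harm_pow_def sum_distrib_left)
  finally have "congp 1 (harm_pow s (p - 1) - (\<Sum>i=1..p-m. 1 / of_nat (p - i) ^ s)) (0 - (-1) ^ s * harm_pow s (p - m))"
    using harm_pow_pideal_1[of s] assms by (intro congp_diff) (auto simp: congp_def)
  then have "congp 1 (harm_pow s (m - 1)) (- ((-1) ^ s * harm_pow s (p - m)))"
    unfolding * by simp
  then have "congp 1 (- ((-1) ^ s) * harm_pow s (m - 1)) (- ((-1) ^ s) * - ((-1) ^ s * harm_pow s (p - m)))"
    by (rule congp_mult_left) (intro pideal_uminus pideal_power pideal_1)
  then have "congp 1 (- ((-1) ^ s * harm_pow s (m - 1))) (harm_pow s (p - m))"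
    by (cases "even s"; simp)
  then show ?thesis
    by (rule congp_sym)
qed

text \<open>The coefficient of \<open>p\<close> when the transform in the duality formula is expanded modulo \<open>p\<^sup>2\<close>.\<close>

definition weighted_sum :: "nat \<Rightarrow> nat \<Rightarrow> rat" where
  "weighted_sum s t = (\<Sum>m=1..p-1. harm_pow 1 m * (harm_pow s m / of_nat m ^ t))"

text \<open>Although this is a sum of depth three, its weight \<open>s + t + 1\<close> is odd, and so the reflection
  \<open>m \<mapsto> p - m\<close> reproduces it with the opposite sign, up to sums of smaller depth: the reflected partial
  sums end at \<open>m - 1\<close> instead of \<open>m\<close>.\<close>

lemma weighted_sum_even_weight:
  assumes "even (s + t)" "0 < s" "0 < t" "s + t + 1 < p - 1"
  shows "congp 1 (2 * weighted_sum s t) (double_sum s (t + 1) + double_sum 1 (s + t))"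
proof -
  have p: "1 < p - 1" using assms by simp
  have sign: "(-1) ^ s * (-1) ^ t = (1 :: rat)"
    using assms(1) by (simp flip: power_add)
  have "weighted_sum s t = (\<Sum>m=1..p-1. harm_pow 1 (p - m) * (harm_pow s (p - m) * (1 / of_nat (p - m) ^ t)))"
    unfolding weighted_sum_def
    by (rule sum.reindex_bij_witness[where i = "\<lambda>j. p - j" and j = "\<lambda>j. p - j"]) auto
  also have "congp 1 \<dots> (\<Sum>m=1..p-1. harm_pow 1 (m - 1) * (- ((-1) ^ s * harm_pow s (m - 1)) * ((-1) ^ t / of_nat m ^ t)))"
  proof (intro congp_sum)
    fix m assume "m \<in> {1..p-1}"
    then have m: "0 < m" "1 \<le> m" "m < p" "p - m < p" "m - 1 < p" "0 < p - m" by auto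
    have "congp 1 (harm_pow 1 (p - m) * (harm_pow s (p - m) * (1 / of_nat (p - m) ^ t)))
        (- ((-1) ^ 1 * harm_pow 1 (m - 1)) * (harm_pow s (p - m) * (1 / of_nat (p - m) ^ t)))"
      using m assms p
      by (intro congp_mult_right harm_pow_reflect pideal_mult_left harm_pow_pideal pideal_inverse_power) auto
    also have "congp 1 \<dots> (- ((-1) ^ 1 * harm_pow 1 (m - 1)) *
        (- ((-1) ^ s * harm_pow s (m - 1)) * (1 / of_nat (p - m) ^ t)))"
      using m assms p
      by (intro congp_mult_left congp_mult_right harm_pow_reflect pideal_mult_left harm_pow_pideal
          pideal_inverse_power pideal_uminus pideal_power pideal_1) auto
    also have "congp 1 \<dots> (- ((-1) ^ 1 * harm_pow 1 (m - 1)) *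
        (- ((-1) ^ s * harm_pow s (m - 1)) * ((-1) ^ t / of_nat m ^ t)))"
      using m
      by (intro congp_mult_left inverse_reflect_1 pideal_mult_left harm_pow_pideal
          pideal_uminus pideal_power pideal_1) auto
    finally show "congp 1 (harm_pow 1 (p - m) * (harm_pow s (p - m) * (1 / of_nat (p - m) ^ t)))
        (harm_pow 1 (m - 1) * (- ((-1) ^ s * harm_pow s (m - 1)) * ((-1) ^ t / of_nat m ^ t)))"
      by simp
  qed
  also have "(\<Sum>m=1..p-1. harm_pow 1 (m - 1) * (- ((-1) ^ s * harm_pow s (m - 1)) * ((-1) ^ t / of_nat m ^ t))) =
      (\<Sum>m=1..p-1. - (harm_pow 1 m * (harm_pow s m / of_nat m ^ t)) + harm_pow s m / of_nat m ^ (t + 1)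
        + harm_pow 1 m / of_nat m ^ (s + t) - 1 / of_nat m ^ (s + t + 1))"
  proof (intro sum.cong refl)
    fix m assume "m \<in> {1..p-1}"
    then obtain n where m: "m = Suc n" by (cases m) auto
    have "harm_pow 1 (m - 1) * (- ((-1) ^ s * harm_pow s (m - 1)) * ((-1) ^ t / of_nat m ^ t)) =
        - (((-1) ^ s * (-1) ^ t) * (harm_pow 1 (m - 1) * harm_pow s (m - 1) / of_nat m ^ t))"
      by simp
    also have "\<dots> = - ((harm_pow 1 m - 1 / of_nat m) * (harm_pow s m - 1 / of_nat m ^ s) / of_nat m ^ t)"
      unfolding sign by (simp add: m harm_pow_Suc)
    also have "\<dots> = - (harm_pow 1 m * (harm_pow s m / of_nat m ^ t)) + harm_pow s m / of_nat m ^ (t + 1)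
        + harm_pow 1 m / of_nat m ^ (s + t) - 1 / of_nat m ^ (s + t + 1)"
      by (simp add: power_add algebra_simps add_divide_distrib diff_divide_distrib)
    finally show "harm_pow 1 (m - 1) * (- ((-1) ^ s * harm_pow s (m - 1)) * ((-1) ^ t / of_nat m ^ t)) = \<dots>" .
  qed
  also have "\<dots> = - weighted_sum s t + double_sum s (t + 1) + double_sum 1 (s + t) - harm_pow (s + t + 1) (p - 1)"
    unfolding weighted_sum_def double_sum_def harm_pow_def[of "s + t + 1"]
    by (simp only: sum.distrib sum_subtractf sum_negf)
  finally have "weighted_sum s t - (- weighted_sum s t + double_sum s (t + 1) + double_sum 1 (s + t)
      - harm_pow (s + t + 1) (p - 1)) \<in> pideal 1"
    by (simp only: congp_def)
  moreover have "harm_pow (s + t + 1) (p - 1) \<in> pideal 1"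
    using assms by (intro harm_pow_pideal_1) auto
  ultimately have "weighted_sum s t - (- weighted_sum s t + double_sum s (t + 1) + double_sum 1 (s + t)
      - harm_pow (s + t + 1) (p - 1)) - harm_pow (s + t + 1) (p - 1) \<in> pideal 1"
    by (rule pideal_diff)
  also have "weighted_sum s t - (- weighted_sum s t + double_sum s (t + 1) + double_sum 1 (s + t)
      - harm_pow (s + t + 1) (p - 1)) - harm_pow (s + t + 1) (p - 1) =
      2 * weighted_sum s t - (double_sum s (t + 1) + double_sum 1 (s + t))"
    by simp
  finally show ?thesis by (simp only: congp_def)
qed

section \<open>Sums over repeated ones\<close>

lemma mhs_pideal: "n < p \<Longrightarrow> mhs n s \<in> pideal 0"
proof (induction s arbitrary: n rule: rev_induct)
  case (snoc t s)
  then show ?case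
    unfolding mhs_snoc by (intro pideal_sum divide_power_pideal) auto
qed simp

lemma mhs_star_pideal: "n < p \<Longrightarrow> mhs_star n s \<in> pideal 0"
proof (induction s arbitrary: n rule: rev_induct)
  case (snoc t s)
  then show ?case
    unfolding mhs_star_snoc by (intro pideal_sum divide_power_pideal) auto
qed simp

lemma mhs_star_ones_two_ones_cong:
  "congp 2 (mhs_star (p - 1) (replicate a 1 @ [2] @ replicate b 1))
    (- double_sum (a + 1) (b + 1) + of_nat p * weighted_sum (a + 1) (b + 1))"
proof -
  have "p - 1 \<ge> 1" using prime_gt_1_nat[OF prime] by simp
  then show ?thesis
    unfolding mhs_star_ones_two_ones[OF \<open>p - 1 \<ge> 1\<close>] double_sum_def weighted_sum_def
    by (intro binom_transform_cong divide_power_pideal harm_pow_pideal) auto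
qed

lemma mhs_star_ones_cong:
  "congp 2 (mhs_star (p - 1) (replicate w 1)) (- harm_pow w (p - 1) + of_nat p * double_sum 1 w)"
proof -
  have *: "p - 1 \<ge> 1" using prime_gt_1_nat[OF prime] by simp
  have "congp 2 (binom_transform (\<lambda>m. 1 / of_nat m ^ w) (p - 1))
     (- (\<Sum>m=1..p-1. 1 / of_nat m ^ w) + of_nat p * (\<Sum>m=1..p-1. harm_pow 1 m * (1 / of_nat m ^ w)))"
    by (intro binom_transform_cong pideal_inverse_power) auto
  then show ?thesis
    unfolding mhs_star_ones[OF *] double_sum_def harm_pow_def[of w] by simp
qed

lemma p_mult_pideal: "x \<in> pideal 0 \<Longrightarrow> of_nat p * x \<in> pideal 1"
  by (rule pideal_mult_right[OF pideal_p])

lemma mhs_star_ones_pideal_1: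
  assumes "0 < w" "w < p - 1"
  shows "mhs_star (p - 1) (replicate w 1) \<in> pideal 1"
proof (rule congp_pideal)
  show "congp 1 (mhs_star (p - 1) (replicate w 1)) (- harm_pow w (p - 1) + of_nat p * double_sum 1 w)"
    using mhs_star_ones_cong by (rule congp_antimono) simp
  show "- harm_pow w (p - 1) + of_nat p * double_sum 1 w \<in> pideal 1"
    using assms by (intro pideal_add pideal_uminus harm_pow_pideal_1 p_mult_pideal double_sum_pideal)
qed

text \<open>In Newton's identity all terms but the last are products of two multiples of \<open>p\<close>.\<close>

lemma mhs_star_ones_newton:
  assumes "0 < w" "w < p - 1"
  shows "congp 2 (of_nat w * mhs_star (p - 1) (replicate w 1)) (harm_pow w (p - 1))"
proof -
  obtain v where v: "w = Suc v" using assms by (cases w) auto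
  have "of_nat w * mhs_star (p - 1) (replicate w 1) =
      (\<Sum>i=1..v. harm_pow i (p - 1) * mhs_star (p - 1) (replicate (w - i) 1)) + harm_pow w (p - 1)"
    unfolding newton_identity by (simp add: v del: One_nat_def)
  moreover have "(\<Sum>i=1..v. harm_pow i (p - 1) * mhs_star (p - 1) (replicate (w - i) 1)) \<in> pideal 2"
    using assms v by (intro pideal_sum pideal_mult_11 harm_pow_pideal_1 mhs_star_ones_pideal_1) auto
  ultimately show ?thesis by (simp add: congp_def)
qed

text \<open>Reflection says nothing about a power sum of even exponent modulo \<open>p\<^sup>2\<close>. Instead, the complete
  symmetric function of degree \<open>w\<close> is evaluated twice modulo \<open>p\<^sup>2\<close>: by Newton's identity it is
  \<open>harm_pow w (p - 1) / w\<close>, and by the binomial transform it is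
  \<open>- harm_pow w (p - 1) + p * double_sum 1 w\<close>. Comparing the two solves for the power sum.\<close>

lemma harm_pow_even_cong:
  assumes "even w" "0 < w" "w + 2 < p"
  shows "congp 2 (of_nat (w + 1) * harm_pow w (p - 1)) (of_nat p * (of_nat w * bernoulli (p - w - 1)))"
proof -
  have "congp 2 (of_nat w * mhs_star (p - 1) (replicate w 1))
      (of_nat w * (- harm_pow w (p - 1) + of_nat p * double_sum 1 w))"
    by (intro congp_mult_left mhs_star_ones_cong) simp
  moreover have "congp 2 (harm_pow w (p - 1)) (of_nat w * mhs_star (p - 1) (replicate w 1))"
    using assms by (intro congp_sym[OF mhs_star_ones_newton]) auto
  ultimately have "congp 2 (harm_pow w (p - 1)) (of_nat w * (- harm_pow w (p - 1) + of_nat p * double_sum 1 w))"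
    by (rule congp_trans[rotated])
  then have "congp 2 (of_nat (w + 1) * harm_pow w (p - 1)) (of_nat p * (of_nat w * double_sum 1 w))"
    by (simp add: congp_def algebra_simps)
  also have "congp 2 \<dots> (of_nat p * (of_nat w * bernoulli (p - w - 1)))"
  proof (intro congp_mult_p congp_mult_left)
    have "congp 1 (double_sum 1 w)
        ((-1) ^ w / of_nat (1 + w) * of_nat ((1 + w) choose 1) * bernoulli (p - 1 - w))"
      using assms by (intro double_sum_bernoulli) auto
    moreover have "p - 1 - w = p - w - 1" by simp
    moreover have "(-1) ^ w / of_nat (1 + w) * of_nat ((1 + w) choose 1) = (1 :: rat)"
      using assms by (simp del: of_nat_Suc)
    ultimately show "congp 1 (double_sum 1 w) (bernoulli (p - w - 1))"
      by (simp only: mult_1)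
  qed simp
  finally show ?thesis .
qed

text \<open>Reflection changes the sign of an odd power sum, up to \<open>p\<close> times a power sum of even exponent
  that is itself divisible by \<open>p\<close>.\<close>

lemma harm_pow_odd_pideal_2:
  assumes "odd w" "w + 1 < p - 1"
  shows "harm_pow w (p - 1) \<in> pideal 2"
proof -
  have w: "0 < w" using assms by (auto intro: Nat.gr0I)
  have "harm_pow w (p - 1) = (\<Sum>k=1..p-1. 1 / of_nat (p - k) ^ w)"
    unfolding harm_pow_def
    by (rule sum.reindex_bij_witness[where i = "\<lambda>j. p - j" and j = "\<lambda>j. p - j"]) auto
  also have "congp 2 \<dots> (\<Sum>k=1..p-1. (-1) ^ w / of_nat k ^ w * (1 + of_nat p * of_nat w / of_nat k))"
    by (intro congp_sum inverse_reflect) auto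
  also have "\<dots> = - harm_pow w (p - 1) - of_nat p * (of_nat w * harm_pow (w + 1) (p - 1))"
    using assms(1)
    by (simp add: harm_pow_def sum_distrib_left algebra_simps add_divide_distrib sum_subtractf sum_negf
        sum.distrib)
  finally have "harm_pow w (p - 1) - (- harm_pow w (p - 1) - of_nat p * (of_nat w * harm_pow (w + 1) (p - 1))) \<in> pideal 2"
    by (simp only: congp_def)
  moreover have "of_nat p * (of_nat w * harm_pow (w + 1) (p - 1)) \<in> pideal 2"
    using assms w by (intro pideal_mult_11 pideal_p pideal_mult_left harm_pow_pideal_1) auto
  ultimately have "harm_pow w (p - 1) - (- harm_pow w (p - 1) - of_nat p * (of_nat w * harm_pow (w + 1) (p - 1)))
      - of_nat p * (of_nat w * harm_pow (w + 1) (p - 1)) \<in> pideal 2"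
    by (rule pideal_diff)
  then have "of_nat 2 * harm_pow w (p - 1) \<in> pideal 2"
    by simp
  then show ?thesis
    by (rule pideal_cancel) (use assms in auto)
qed

lemma mhs_star_ones_pideal_2:
  assumes "odd w" "w + 1 < p - 1"
  shows "mhs_star (p - 1) (replicate w 1) \<in> pideal 2"
proof -
  have w: "0 < w" using assms by (auto intro: Nat.gr0I)
  have "of_nat w * mhs_star (p - 1) (replicate w 1) \<in> pideal 2"
    using assms w by (intro congp_pideal[OF mhs_star_ones_newton harm_pow_odd_pideal_2]) auto
  then show ?thesis
    by (rule pideal_cancel) (use assms w in auto)
qed

text \<open>The elementary symmetric functions inherit their divisibility from the complete ones through the
  antipode relation.\<close>

lemma mhs_ones_pideal:
  assumes "0 < w" "w < p - 1"
  shows "mhs (p - 1) (replicate w 1) \<in> pideal 1"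
    and "odd w \<Longrightarrow> w + 1 < p - 1 \<Longrightarrow> mhs (p - 1) (replicate w 1) \<in> pideal 2"
proof -
  define h where "h i = mhs_star (p - 1) (replicate i 1)" for i
  define e where "e i = mhs (p - 1) (replicate i 1)" for i
  have p1: "p - 1 < p" using prime_gt_0_nat[OF prime] by simp
  have rel: "e w = - (\<Sum>i=1..w. (-1) ^ i * h i * e (w - i))" if "0 < w" for w
  proof -
    have "0 = (\<Sum>i\<le>w. (-1) ^ i * h i * e (w - i))"
      using mhs_antipode[of "replicate w 1" "p - 1"] that by (simp add: h_def e_def min_def)
    also have "\<dots> = e w + (\<Sum>i=1..w. (-1) ^ i * h i * e (w - i))"
      by (simp add: h_def sum.atMost_shift sum.atLeast1_atMost_eq lessThan_Suc_atMost)
    finally show ?thesis by simp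
  qed
  have e1: "e v \<in> pideal 1" if "0 < v" "v < p - 1" for v
    unfolding rel[OF that(1)] using that p1 unfolding h_def e_def
    by (intro pideal_uminus pideal_sum pideal_mult_right mhs_star_ones_pideal_1 mhs_pideal
        pideal_mult_left pideal_power pideal_1) auto
  then show "mhs (p - 1) (replicate w 1) \<in> pideal 1"
    using assms by (simp add: e_def)
  assume odd: "odd w" "w + 1 < p - 1"
  have "e w \<in> pideal 2"
    unfolding rel[OF assms(1)]
  proof (intro pideal_uminus pideal_sum)
    fix i assume i: "i \<in> {1..w}"
    show "(-1) ^ i * h i * e (w - i) \<in> pideal 2"
    proof (cases "i = w")
      case True
      then show ?thesis
        using odd pideal_uminus[OF mhs_star_ones_pideal_2[of w]] unfolding h_def e_def by simp
    next
      case False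
      then show ?thesis
        using i odd e1[of "w - i"] unfolding h_def
        by (intro pideal_mult_11 pideal_mult_left mhs_star_ones_pideal_1 pideal_uminus pideal_power pideal_1) auto
    qed
  qed
  then show "mhs (p - 1) (replicate w 1) \<in> pideal 2"
    by (simp add: e_def)
qed

section \<open>The star sums\<close>

lemma mhs_star_odd_cong:
  assumes "odd (a + b)" "a + b + 3 < p"
  shows "congp 1 (mhs_star (p - 1) (replicate a 1 @ [2] @ replicate b 1))
    ((-1) ^ b / of_nat (a + b + 2) * of_nat ((a + b + 2) choose (a + 1)) * bernoulli (p - a - b - 2))"
proof -
  define w where "w = a + b + 2"
  have "congp 1 (mhs_star (p - 1) (replicate a 1 @ [2] @ replicate b 1))
      (- double_sum (a + 1) (b + 1) + of_nat p * weighted_sum (a + 1) (b + 1))"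
    using mhs_star_ones_two_ones_cong by (rule congp_antimono) simp
  also have "congp 1 \<dots> (- ((-1) ^ (b + 1) / of_nat w * of_nat (w choose (a + 1)) * bernoulli (p - w)) + 0)"
  proof (intro congp_add congp_uminus)
    have "congp 1 (double_sum (a + 1) (b + 1))
        ((-1) ^ (b + 1) / of_nat (a + 1 + (b + 1)) * of_nat ((a + 1 + (b + 1)) choose (a + 1)) *
          bernoulli (p - (a + 1) - (b + 1)))"
      using assms by (intro double_sum_bernoulli) auto
    moreover have "a + 1 + (b + 1) = w" "p - (a + 1) - (b + 1) = p - w"
      by (simp_all add: w_def)
    ultimately show "congp 1 (double_sum (a + 1) (b + 1))
        ((-1) ^ (b + 1) / of_nat w * of_nat (w choose (a + 1)) * bernoulli (p - w))"
      by (simp only:)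
    have "weighted_sum (a + 1) (b + 1) \<in> pideal 0"
      unfolding weighted_sum_def
      by (intro pideal_sum pideal_mult_left divide_power_pideal harm_pow_pideal) auto
    then show "congp 1 (of_nat p * weighted_sum (a + 1) (b + 1)) 0"
      by (simp only: congp_0_iff p_mult_pideal)
  qed
  also have "- ((-1) ^ (b + 1) / of_nat w * of_nat (w choose (a + 1)) * bernoulli (p - w)) + 0 =
      (-1) ^ b / of_nat w * of_nat (w choose (a + 1)) * bernoulli (p - w)"
    by simp
  also have "p - w = p - a - b - 2" by (simp add: w_def)
  finally show ?thesis by (simp only: w_def)
qed

text \<open>All ingredients are multiples of the single number \<open>p * B / N\<close>, where \<open>N = a + b + 3\<close> is the odd
  weight of the double sums that occur in the coefficient of \<open>p\<close>. Their binomial coefficients combine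
  through \<open>(t + 1) * (N choose (t + 1)) = (s + 1) * (N choose t)\<close>.\<close>

lemma mhs_star_even_cong:
  assumes "even (a + b)" "a + b + 3 < p"
  shows "congp 2 (mhs_star (p - 1) (replicate a 1 @ [2] @ replicate b 1))
    (of_nat p * bernoulli (p - a - b - 3) / (2 * of_nat (a + b + 3))
      * (1 + (- 1) ^ a * of_nat ((a + b + 3) choose (a + 2))))"
proof -
  define s where "s = a + 1"
  define t where "t = b + 1"
  define N where "N = s + t + 1"
  define B where "B = bernoulli (p - N)"
  define \<epsilon> where "\<epsilon> = ((-1) ^ s :: rat)"
  have N: "N = a + b + 3" "p - a - b - 3 = p - N" by (simp_all add: N_def s_def t_def)
  \<comment> \<open>The hypothesis only gives \<open>N \<le> p - 1\<close>, but the two sides have different parity. The strict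
    inequality keeps \<open>p - 1\<close> from dividing the exponent of a power sum.\<close>
  have N_less: "N < p - 1"
  proof -
    have "odd N" using assms(1) by (simp add: N)
    moreover have "even (p - 1)"
      using assms prime_odd_nat[OF prime] by simp
    ultimately have "N \<noteq> p - 1" by metis
    then show ?thesis using assms(2) by (simp add: N)
  qed
  have ev: "even (s + t)" using assms(1) by (simp add: s_def t_def)
  have pos: "0 < s" "0 < t" by (simp_all add: s_def t_def)
  have \<epsilon>_t: "(-1) ^ t = \<epsilon>"
    using ev unfolding \<epsilon>_def by (simp add: minus_one_power_iff)
  define c where "c = (of_nat (N choose t) :: rat)"
  define d where "d = (of_nat (N choose (t + 1)) :: rat)"
  have c_sym: "of_nat (N choose (s + 1)) = c" and d_sym: "of_nat (N choose s) = d"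
    unfolding c_def d_def using binomial_symmetric[of "s + 1" N] binomial_symmetric[of s N]
    by (simp_all add: N_def)
  have cd: "of_nat (t + 1) * d = of_nat (s + 1) * c"
  proof -
    have "(t + 1) * (N choose (t + 1)) = (N - t) * (N choose t)"
      using binomial_absorb_comp[of N t] binomial_absorption[of t N] by simp
    then show ?thesis
      unfolding c_def d_def of_nat_mult[symmetric] by (simp add: N_def)
  qed
  have dbl: "congp 1 (double_sum i j) ((-1) ^ j / of_nat N * of_nat (N choose i) * B)"
    if "0 < i" "0 < j" "i + j = N" for i j
  proof -
    have "congp 1 (double_sum i j) ((-1) ^ j / of_nat (i + j) * of_nat ((i + j) choose i) * bernoulli (p - i - j))"
      using that N_less by (intro double_sum_bernoulli) auto
    moreover have "p - i - j = p - N" using that by simp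
    ultimately show ?thesis unfolding B_def that(3) by (simp only:)
  qed
  have d1: "congp 1 (double_sum t (s + 1)) (- \<epsilon> / of_nat N * c * B)"
    using dbl[of t "s + 1"] pos by (simp add: N_def \<epsilon>_def c_def)
  have d2: "congp 1 (double_sum (t + 1) s) (\<epsilon> / of_nat N * d * B)"
    using dbl[of "t + 1" s] pos by (simp add: N_def \<epsilon>_def d_def)
  have d3: "congp 1 (double_sum s (t + 1)) (- \<epsilon> / of_nat N * d * B)"
    using dbl[of s "t + 1"] pos d_sym by (simp add: N_def \<epsilon>_t)
  have d4: "congp 1 (double_sum 1 (s + t)) B"
    using dbl[of 1 "s + t"] pos ev by (simp add: N_def del: of_nat_Suc)
  have weight: "congp 2 (harm_pow (s + t) (p - 1)) (of_nat p * (of_nat (s + t) / of_nat N * B))"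
  proof (rule congp_cancel)
    have "congp 2 (of_nat (s + t + 1) * harm_pow (s + t) (p - 1))
        (of_nat p * (of_nat (s + t) * bernoulli (p - (s + t) - 1)))"
      using ev pos N_less by (intro harm_pow_even_cong) (auto simp: N_def)
    moreover have "p - (s + t) - 1 = p - N" by (simp add: N_def)
    ultimately show "congp 2 (of_nat N * harm_pow (s + t) (p - 1))
        (of_nat N * (of_nat p * (of_nat (s + t) / of_nat N * B)))"
      by (simp add: N_def B_def mult_ac del: of_nat_Suc of_nat_add)
  qed (use N_less in \<open>auto simp: N_def\<close>)
  have "congp 2 (2 * mhs_star (p - 1) (replicate a 1 @ [2] @ replicate b 1))
      (2 * (- double_sum s t + of_nat p * weighted_sum s t))"
    unfolding s_def t_def by (intro congp_mult_left mhs_star_ones_two_ones_cong) simp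
  also have "\<dots> = of_nat p * (2 * weighted_sum s t) - 2 * double_sum s t"
    by (simp add: algebra_simps)
  also have "congp 2 \<dots> (of_nat p * (double_sum s (t + 1) + double_sum 1 (s + t)) -
      (harm_pow (s + t) (p - 1) +
        of_nat p * (of_nat s * double_sum t (s + 1) + of_nat t * double_sum (t + 1) s)))"
    using ev pos N_less
    by (intro congp_diff congp_mult_p weighted_sum_even_weight double_sum_even_weight) (auto simp: N_def)
  also have "congp 2 \<dots> (of_nat p * (- \<epsilon> / of_nat N * d * B + B) -
      (of_nat p * (of_nat (s + t) / of_nat N * B) +
        of_nat p * (of_nat s * (- \<epsilon> / of_nat N * c * B) + of_nat t * (\<epsilon> / of_nat N * d * B))))"
    by (intro congp_diff congp_add congp_mult_p congp_mult_left weight d1 d2 d3 d4) auto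
  also have "\<dots> = of_nat p * B / of_nat N *
      (of_nat N - of_nat (s + t) + \<epsilon> * (of_nat s * c - of_nat (t + 1) * d))"
  proof -
    have "of_nat N \<noteq> (0 :: rat)" by (simp add: N_def del: of_nat_Suc)
    then show ?thesis by (simp add: field_simps)
  qed
  also have "\<dots> = of_nat p * B / of_nat N * (1 - \<epsilon> * c)"
    unfolding cd by (simp add: N_def algebra_simps)
  also have "\<dots> = of_nat 2 * (of_nat p * B / (2 * of_nat N) * (1 - \<epsilon> * c))"
    by simp
  finally have "congp 2 (of_nat 2 * mhs_star (p - 1) (replicate a 1 @ [2] @ replicate b 1))
      (of_nat 2 * (of_nat p * B / (2 * of_nat N) * (1 - \<epsilon> * c)))"
    by (simp only: of_nat_numeral)
  then have "congp 2 (mhs_star (p - 1) (replicate a 1 @ [2] @ replicate b 1))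
      (of_nat p * B / (2 * of_nat N) * (1 - \<epsilon> * c))"
    by (rule congp_cancel) (use N_less pos in \<open>auto simp: N_def\<close>)
  moreover have "1 - \<epsilon> * c = 1 + (-1) ^ a * of_nat (N choose (a + 2))"
    using c_sym by (simp add: \<epsilon>_def s_def)
  ultimately show ?thesis
    unfolding N B_def by (simp only: N(1)[symmetric])
qed

section \<open>From star sums to strict sums\<close>

lemma mhs_antipode_ones_two_ones:
  "mhs n (replicate b 1 @ [2] @ replicate a 1) =
    (-1) ^ (a + b) * mhs_star n (replicate a 1 @ [2] @ replicate b 1)
    - (\<Sum>i=1..a. (-1) ^ i * mhs_star n (replicate i 1) * mhs n (replicate b 1 @ [2] @ replicate (a - i) 1))
    + (-1) ^ a * (\<Sum>i<b. (-1) ^ i * mhs_star n (replicate a 1 @ [2] @ replicate i 1) * mhs n (replicate (b - i) 1))"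
proof -
  define s :: "nat list" where "s = replicate a 1 @ [2] @ replicate b 1"
  define F where "F i = (-1) ^ i * mhs_star n (take i s) * mhs n (rev (drop i s))" for i
  have F_low: "F i = (-1) ^ i * mhs_star n (replicate i 1) * mhs n (replicate b 1 @ [2] @ replicate (a - i) 1)"
    if "i \<le> a" for i
    using that by (simp add: F_def s_def min_def)
  have F_high: "F (a + 1 + i) = - ((-1) ^ a * ((-1) ^ i * mhs_star n (replicate a 1 @ [2] @ replicate i 1) *
      mhs n (replicate (b - i) 1)))" if "i \<le> b" for i
    using that by (simp add: F_def s_def min_def power_add)
  have "0 = (\<Sum>i\<le>a + 1 + b. F i)"
    using mhs_antipode[of s n] by (simp add: F_def s_def)
  also have "{..a + 1 + b} = insert 0 {1..a} \<union> ((\<lambda>i. a + 1 + i) ` {..<b} \<union> {a + 1 + b})"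
  proof (intro equalityI subsetI)
    fix i assume "i \<in> {..a + 1 + b}"
    then consider "i = 0" | "1 \<le> i" "i \<le> a" | "i = a + 1 + (i - (a + 1))" "i - (a + 1) < b" | "i = a + 1 + b"
      by fastforce
    then show "i \<in> insert 0 {1..a} \<union> ((\<lambda>i. a + 1 + i) ` {..<b} \<union> {a + 1 + b})"
      by cases (auto intro: rev_image_eqI)
  qed auto
  also have "sum F \<dots> = F 0 + (\<Sum>i=1..a. F i) + ((\<Sum>i<b. F (a + 1 + i)) + F (a + 1 + b))"
    by (subst sum.union_disjoint; (subst sum.union_disjoint)?) (auto simp: sum.reindex inj_on_def)
  also have "(\<Sum>i=1..a. F i) =
      (\<Sum>i=1..a. (-1) ^ i * mhs_star n (replicate i 1) * mhs n (replicate b 1 @ [2] @ replicate (a - i) 1))"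
    by (intro sum.cong refl F_low) auto
  also have "(\<Sum>i<b. F (a + 1 + i)) = - ((-1) ^ a *
      (\<Sum>i<b. (-1) ^ i * mhs_star n (replicate a 1 @ [2] @ replicate i 1) * mhs n (replicate (b - i) 1)))"
    unfolding sum_distrib_left sum_negf[symmetric] by (intro sum.cong refl F_high) auto
  finally show ?thesis
    using F_high[of b] by (simp add: F_low power_add)
qed

text \<open>In the antipode relation, every term but the two extreme ones contains a sum over repeated ones,
  which is a multiple of \<open>p\<close>.\<close>

lemma mhs_rev_mod_p:
  assumes "a + b + 3 < p"
  shows "congp 1 (mhs (p - 1) (replicate b 1 @ [2] @ replicate a 1))
    ((-1) ^ (a + b) * mhs_star (p - 1) (replicate a 1 @ [2] @ replicate b 1))"
proof -
  have p1: "p - 1 < p" using assms by simp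
  have "(\<Sum>i=1..a. (-1) ^ i * mhs_star (p - 1) (replicate i 1) *
      mhs (p - 1) (replicate b 1 @ [2] @ replicate (a - i) 1)) \<in> pideal 1"
    using assms p1
    by (intro pideal_sum pideal_mult_right mhs_pideal pideal_mult_left pideal_power pideal_uminus
        pideal_1 mhs_star_ones_pideal_1) auto
  moreover have "(-1) ^ a * (\<Sum>i<b. (-1) ^ i * mhs_star (p - 1) (replicate a 1 @ [2] @ replicate i 1) *
      mhs (p - 1) (replicate (b - i) 1)) \<in> pideal 1"
    using assms p1
    by (intro pideal_mult_left pideal_sum mhs_ones_pideal(1) mhs_star_pideal pideal_power pideal_uminus pideal_1) auto
  ultimately show ?thesis
    unfolding mhs_antipode_ones_two_ones[of _ b a] congp_def
    using pideal_add[OF pideal_uminus] by (simp add: algebra_simps)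
qed

lemma mhs_star_even_pideal:
  assumes "even (a + b)" "a + b + 3 < p"
  shows "mhs_star (p - 1) (replicate a 1 @ [2] @ replicate b 1) \<in> pideal 1"
proof (rule congp_pideal)
  show "congp 1 (mhs_star (p - 1) (replicate a 1 @ [2] @ replicate b 1))
    (of_nat p * bernoulli (p - a - b - 3) / (2 * of_nat (a + b + 3))
      * (1 + (- 1) ^ a * of_nat ((a + b + 3) choose (a + 2))))"
    using mhs_star_even_cong[OF assms] by (rule congp_antimono) simp
  have "of_nat p * (bernoulli (p - a - b - 3) * (1 / of_nat 2) * (1 / of_nat (a + b + 3))
      * (1 + (- 1) ^ a * of_nat ((a + b + 3) choose (a + 2)))) \<in> pideal 1"
    using assms
    by (intro p_mult_pideal pideal_mult_left pideal_inverse_less bernoulli_pideal pideal_add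
        pideal_power pideal_uminus pideal_1 pideal_of_nat) auto
  then show "of_nat p * bernoulli (p - a - b - 3) / (2 * of_nat (a + b + 3))
      * (1 + (- 1) ^ a * of_nat ((a + b + 3) choose (a + 2))) \<in> pideal 1"
    by (simp add: mult.assoc del: of_nat_add)
qed

lemma mhs_even_pideal:
  assumes "even (a + b)" "a + b + 3 < p"
  shows "mhs (p - 1) (replicate b 1 @ [2] @ replicate a 1) \<in> pideal 1"
  using assms
  by (intro congp_pideal[OF mhs_rev_mod_p] pideal_mult_left mhs_star_even_pideal
      pideal_power pideal_uminus pideal_1) auto

text \<open>Each mixed term of the antipode relation is a sum over \<open>c\<close> repeated ones times a sum with a \<open>2\<close>.
  If \<open>c\<close> is odd, the first factor is divisible by \<open>p\<^sup>2\<close>. If \<open>c\<close> is even, the second has even weight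
  as well, and both factors are divisible by \<open>p\<close>.\<close>

lemma mhs_rev_mod_p2:
  assumes "even (a + b)" "a + b + 3 < p"
  shows "congp 2 (mhs (p - 1) (replicate b 1 @ [2] @ replicate a 1))
    (mhs_star (p - 1) (replicate a 1 @ [2] @ replicate b 1))"
proof -
  have p1: "p - 1 < p" using assms by simp
  have "(\<Sum>i=1..a. (-1) ^ i * mhs_star (p - 1) (replicate i 1) *
      mhs (p - 1) (replicate b 1 @ [2] @ replicate (a - i) 1)) \<in> pideal 2"
  proof (intro pideal_sum)
    fix i assume i: "i \<in> {1..a}"
    show "(-1) ^ i * mhs_star (p - 1) (replicate i 1) *
      mhs (p - 1) (replicate b 1 @ [2] @ replicate (a - i) 1) \<in> pideal 2"
    proof (cases "even i")
      case True
      then show ?thesis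
        using i assms
        by (intro pideal_mult_11 pideal_mult_left mhs_star_ones_pideal_1 mhs_even_pideal pideal_power
            pideal_uminus pideal_1) auto
    next
      case False
      then show ?thesis
        using i assms p1
        by (intro pideal_mult_right[OF pideal_mult_left[OF _ mhs_star_ones_pideal_2]] mhs_pideal pideal_power
            pideal_uminus pideal_1) auto
    qed
  qed
  moreover have "(-1) ^ a * (\<Sum>i<b. (-1) ^ i * mhs_star (p - 1) (replicate a 1 @ [2] @ replicate i 1) *
      mhs (p - 1) (replicate (b - i) 1)) \<in> pideal 2"
  proof (rule pideal_mult_left[OF _ pideal_sum])
    show "(-1) ^ a \<in> pideal 0" by (intro pideal_power pideal_uminus pideal_1)
    fix i assume i: "i \<in> {..<b}"
    show "(-1) ^ i * mhs_star (p - 1) (replicate a 1 @ [2] @ replicate i 1) *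
      mhs (p - 1) (replicate (b - i) 1) \<in> pideal 2"
    proof (cases "even (b - i)")
      case True
      then have "even (a + i)" using i assms by auto
      then show ?thesis
        using i assms
        by (intro pideal_mult_11 pideal_mult_left mhs_ones_pideal(1) mhs_star_even_pideal pideal_power
            pideal_uminus pideal_1) auto
    next
      case False
      then show ?thesis
        using i assms p1
        by (intro pideal_mult_left[OF _ mhs_ones_pideal(2)] pideal_mult_left mhs_star_pideal pideal_power
            pideal_uminus pideal_1) auto
    qed
  qed
  ultimately show ?thesis
    unfolding mhs_antipode_ones_two_ones[of _ b a] congp_def
    using pideal_add[OF pideal_uminus] assms(1) by (simp add: algebra_simps)
qed

end

section \<open>The congruences\<close>

theorem theorem4p3:
  fixes a b p :: nat
  assumes "prime p" and "p > a + b + 3"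
  shows "(odd (a + b) \<longrightarrow>
            rat_cong (mhs_star (p - 1) (replicate a 1 @ [2] @ replicate b 1))
              ((- 1) ^ b / of_nat (a + b + 2) * of_nat ((a + b + 2) choose (a + 1))
                * bernoulli (p - a - b - 2)) p 1
          \<and> rat_cong (mhs (p - 1) (replicate a 1 @ [2] @ replicate b 1))
              ((- 1) ^ b / of_nat (a + b + 2) * of_nat ((a + b + 2) choose (a + 1))
                * bernoulli (p - a - b - 2)) p 1)
       \<and> (even (a + b) \<longrightarrow>
            rat_cong (mhs_star (p - 1) (replicate a 1 @ [2] @ replicate b 1))
              (of_nat p * bernoulli (p - a - b - 3) / (2 * of_nat (a + b + 3))
                * (1 + (- 1) ^ a * of_nat ((a + b + 3) choose (a + 2)))) p 2
          \<and> rat_cong (mhs (p - 1) (replicate a 1 @ [2] @ replicate b 1))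
              (of_nat p * bernoulli (p - a - b - 3) / (2 * of_nat (a + b + 3))
                * (1 + (- 1) ^ a * of_nat ((a + b + 3) choose (b + 2)))) p 2)"
proof -
  interpret rat_mod_prime p
    using assms(1) by unfold_locales
  have *: "b + a + 3 < p" "p - b - a - 2 = p - a - b - 2" "p - b - a - 3 = p - a - b - 3"
    using assms(2) by auto
  show ?thesis
  proof (intro conjI impI rat_congI)
    assume "odd (a + b)"
    then show "congp 1 (mhs_star (p - 1) (replicate a 1 @ [2] @ replicate b 1))
        ((- 1) ^ b / of_nat (a + b + 2) * of_nat ((a + b + 2) choose (a + 1)) * bernoulli (p - a - b - 2))"
      using assms(2) by (rule mhs_star_odd_cong)
  next
    assume odd: "odd (a + b)"
    have "congp 1 (mhs (p - 1) (replicate a 1 @ [2] @ replicate b 1))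
        ((-1) ^ (b + a) * mhs_star (p - 1) (replicate b 1 @ [2] @ replicate a 1))"
      using * by (intro mhs_rev_mod_p)
    also have "congp 1 \<dots> ((-1) ^ (b + a) * ((- 1) ^ a / of_nat (b + a + 2) * of_nat ((b + a + 2) choose (b + 1))
        * bernoulli (p - b - a - 2)))"
      using odd * by (intro congp_mult_left mhs_star_odd_cong pideal_power pideal_uminus pideal_1) (auto simp: add.commute)
    also have "\<dots> = (- 1) ^ b / of_nat (a + b + 2) * of_nat ((a + b + 2) choose (a + 1)) * bernoulli (p - a - b - 2)"
    proof -
      have "(b + a + 2) choose (b + 1) = (a + b + 2) choose (a + 1)"
        using binomial_symmetric[of "b + 1" "b + a + 2"] by (simp add: add.commute)
      moreover have "(-1) ^ (b + a) * (-1) ^ a = ((-1) ^ b :: rat)"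
        by (simp add: power_add mult.assoc flip: power_mult_distrib)
      ultimately show ?thesis
        by (simp add: *(2) add.commute[of b a] flip: mult.assoc times_divide_eq_right)
    qed
    finally show "congp 1 (mhs (p - 1) (replicate a 1 @ [2] @ replicate b 1))
        ((- 1) ^ b / of_nat (a + b + 2) * of_nat ((a + b + 2) choose (a + 1)) * bernoulli (p - a - b - 2))" .
  next
    assume "even (a + b)"
    then show "congp 2 (mhs_star (p - 1) (replicate a 1 @ [2] @ replicate b 1))
        (of_nat p * bernoulli (p - a - b - 3) / (2 * of_nat (a + b + 3))
          * (1 + (- 1) ^ a * of_nat ((a + b + 3) choose (a + 2))))"
      using assms(2) by (rule mhs_star_even_cong)
  next
    assume even: "even (a + b)"
    then have even': "even (b + a)" by (simp add: add.commute)
    have sign: "(-1) ^ b = ((-1) ^ a :: rat)"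
      using even by (simp add: minus_one_power_iff)
    have "congp 2 (mhs (p - 1) (replicate a 1 @ [2] @ replicate b 1))
        (mhs_star (p - 1) (replicate b 1 @ [2] @ replicate a 1))"
      using even' * by (intro mhs_rev_mod_p2)
    also have "congp 2 \<dots> (of_nat p * bernoulli (p - b - a - 3) / (2 * of_nat (b + a + 3))
          * (1 + (- 1) ^ b * of_nat ((b + a + 3) choose (b + 2))))"
      using even' * by (intro mhs_star_even_cong)
    finally show "congp 2 (mhs (p - 1) (replicate a 1 @ [2] @ replicate b 1))
        (of_nat p * bernoulli (p - a - b - 3) / (2 * of_nat (a + b + 3))
          * (1 + (- 1) ^ a * of_nat ((a + b + 3) choose (b + 2))))"
      by (simp only: *(3) add.commute[of b a] sign)
  qed
qed

end
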